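(* Let $\mathcal{G}_2$ be the labeled graph associated with the flag manifold of type $G_2$, and let $H_T^*(\mathcal{G}_2)$ be its graph cohomology ring, containing the elements $\tau_1,\tau_2,\tau_3,t_1,t_2,t_3,f$ defined in the context. Then $$H_T^*(\mathcal{G}_2)=\mathbb{Z}[\tau_1,\tau_2,\tau_3,t_1,t_2,t_3,f]/I,$$ where $$I=\big(e_1(\tau),\ e_2(\tau)-e_2(s),\ 2f-e_3(\tau)-e_3(s),\ f^2-f\,e_3(s)\big),$$ and $e_i(\tau)$ (resp. $e_i(s)$) is the $i$-th elementary symmetric polynomial in $\tau_1,\tau_2,\tau_3$ (resp. in $s_1=t_1-t_2$, $s_2=t_2-t_3$, $s_3=t_3-t_1$). That is, the canonical ring homomorphism from the polynomial ring over $\mathbb{Z}$ in seven variables named $\tau_1,\tau_2,\tau_3,t_1,t_2,t_3,f$ to $H_T^*(\mathcal{G}_2)$, sending each variable to the element of the same name, is well defined, surjective, and has kernel $I$.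
   Context: Root system and Weyl group. $T$ is a 3-dimensional torus, $t_1,t_2,t_3$ is a basis of $H^2(BT)$, and $H^*(BT)$ is identified with $\mathbb{Z}[t_1,t_2,t_3]$, with each $t_i$ of degree $2$. $H^2(BT)$ (and $H^2(BT)\otimes\mathbb{R}$) carries the inner product for which $t_1,t_2,t_3$ is orthonormal. Put $s_1=t_1-t_2$, $s_2=t_2-t_3$, $s_3=t_3-t_1$ (so $s_1+s_2+s_3=0$). The root system of type $G_2$ is $\Phi(G_2)=\{\pm s_k,\ \pm(s_i-s_j)\mid k\in\{1,2,3\},\ 1\le i<j\le 3\}$. For a root $\alpha$, $\sigma_\alpha$ is the orthogonal reflection $x\mapsto x-2\frac{\alpha\cdot x}{\alpha\cdot\alpha}\alpha$. The Weyl group $W(G_2)$ is the group generated by all $\sigma_\alpha$, $\alpha\in\Phi(G_2)$; it is dihedral of order 12, generated by $\sigma_1=\sigma_{s_1}$ and $\sigma_2=\sigma_{s_3-s_1}$. Labeled graph $\mathcal{G}_2$. Its vertex set is $W(G_2)$. Two vertices $w,w'$ are connected by an edge $e$ if and only if $w=w'\sigma_\alpha$ for some $\alpha\in\Phi(G_2)$; the label of $e$ is $\ell(e)=w\alpha\in\mathbb{Z}[t_1,t_2,t_3]$. Labels are considered only up to sign. Graph cohomology. $H_T^*(\mathcal{G}_2)$ is the set of all maps $h:W(G_2)\to\mathbb{Z}[t_1,t_2,t_3]$ such that for any two vertices $w,w'$ connected by an edge $e$, $h(w)-h(w')$ is divisible by $\ell(e)$ in $\mathbb{Z}[t_1,t_2,t_3]$.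 It is a ring under pointwise operations. Identification of vertices. Let $\Phi=\{\pm(s_i-s_j)\mid 1\le i<j\le 3\}$, let $W(\Phi)\subset W(G_2)$ be the subgroup generated by the reflections $\sigma_\alpha$, $\alpha\in\Phi$, and let $\psi:W(\Phi)\to S_3$ be the group isomorphism with $\psi(\sigma_{s_i-s_j})=(i,j)$ (transposition). Let $\rho=(\sigma_1\sigma_2)^3$; then $W(G_2)=W(\Phi)\amalg\rho W(\Phi)$ as a set. The vertex set $W(G_2)$ is identified with $S_3\times\{+,-\}$ by the bijection sending $w\in W(\Phi)$ to $(\psi(w),+)$ and $\rho w$ to $(\psi(w),-)$. Elements. For $i=1,2,3$ and $w=(v,\varepsilon)\in S_3\times\{\pm\}$: $\tau_i(w)=\varepsilon s_{v(i)}$ (where $\varepsilon=\pm$ acts as the sign $\pm1$), $t_i(w)=t_i$ (constant map), and $f(w)=s_1s_2s_3$ if $\varepsilon=+$, $f(w)=0$ if $\varepsilon=-$. These are elements of $H_T^*(\mathcal{G}_2)$. *)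

theory Defs
  imports
    "HOL-Analysis.Cartesian_Space"
    "HOL-Algebra.Bij"
    "HOL-Algebra.Elementary_Groups"
    "HOL-Algebra.RingHom"
    "HOL-Library.Poly_Mapping"
    "HOL-Combinatorics.Permutations"
begin

section \<open>Integer polynomials in an indexed family of variables\<close>

text \<open>
  The monoid algebra over the integers of the finitely supported exponent vectors on
  \<open>'x\<close>, i.e. the polynomial ring with one variable \<open>var x\<close> for each \<open>x :: 'x\<close>. The ring
  $\mathbf{Z}[t_1,t_2,t_3]$ is \<open>3 int_poly\<close>. The index type \<open>3\<close> consists of the residues
  modulo 3, so \<open>i + 1\<close> is the cyclic successor of \<open>i\<close> and \<open>3 + 1 = 1\<close>.
\<close>

type_synonym 'x int_poly = "('x \<Rightarrow>\<^sub>0 nat) \<Rightarrow>\<^sub>0 int"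

definition var :: "'x \<Rightarrow> 'x int_poly" where
  "var x = Poly_Mapping.single (Poly_Mapping.single x 1) 1"

definition poly_eval :: "('x \<Rightarrow> 'r::comm_ring_1) \<Rightarrow> 'x int_poly \<Rightarrow> 'r" where
  "poly_eval g p =
     (\<Sum>m\<in>Poly_Mapping.keys p.
        of_int (Poly_Mapping.lookup p m) *
        (\<Prod>x\<in>Poly_Mapping.keys m. g x ^ Poly_Mapping.lookup m x))"

text \<open>The elementary symmetric polynomial of degree \<open>k\<close> in \<open>x\<^sub>1, x\<^sub>2, x\<^sub>3\<close>.\<close>

definition elem_sym :: "nat \<Rightarrow> (3 \<Rightarrow> 'a::comm_ring_1) \<Rightarrow> 'a" where
  "elem_sym k x = (\<Sum>A\<in>{A. card A = k}. \<Prod>i\<in>A. x i)"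

text \<open>
  \<open>s_of t\<close> is the family $s_vec 1=t_1-t_2$, $s_2=t_2-t_3$, $s_3=t_3-t_1$; it is used with the
  \<open>t\<^sub>i\<close> taken as basis vectors and as variables.
\<close>

definition s_of :: "(3 \<Rightarrow> 'a::ab_group_add) \<Rightarrow> 3 \<Rightarrow> 'a" where
  "s_of t i = t i - t (i + 1)"


section \<open>Root system and Weyl group\<close>

text \<open>
  $H^2(BT)\otimes\mathbf{R}$ is \<open>real^3\<close> with its standard inner product, \<open>t\<^sub>i\<close> being the
  \<open>i\<close>-th standard basis vector.
\<close>

definition s_vec :: "3 \<Rightarrow> real^3" where
  "s_vec = s_of (\<lambda>i. axis i 1)"

text \<open>Ranging over ordered pairs \<open>i \<noteq> j\<close> accounts for both signs of \<open>s\<^sub>i - s\<^sub>j\<close> with \<open>i < j\<close>.\<close>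

definition long_roots :: "(real^3) set" where
  "long_roots = {s_vec i - s_vec j | i j. i \<noteq> j}"

definition G2_roots :: "(real^3) set" where
  "G2_roots = range s_vec \<union> range (\<lambda>k. - s_vec k) \<union> long_roots"

definition reflection :: "real^3 \<Rightarrow> real^3 \<Rightarrow> real^3" where
  "reflection \<alpha> x = x - (2 * (\<alpha> \<bullet> x) / (\<alpha> \<bullet> \<alpha>)) *\<^sub>R \<alpha>"

definition weyl_group :: "(real^3) set \<Rightarrow> (real^3 \<Rightarrow> real^3) monoid" where
  "weyl_group R = subgroup_generated (BijGroup UNIV) (reflection ` R)"

abbreviation W_G2 :: "(real^3 \<Rightarrow> real^3) set" where
  "W_G2 \<equiv> carrier (weyl_group G2_roots)"

abbreviation W_long :: "(real^3 \<Rightarrow> real^3) set" where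
  "W_long \<equiv> carrier (weyl_group long_roots)"


section \<open>The labeled graph and its cohomology ring\<close>

text \<open>
  The element of $H^2(BT)\subset\mathbf{Z}[t_1,t_2,t_3]$ given by an integral vector. Labels
  are roots, hence integral (\<open>weyl_root\<close> and \<open>root_integral\<close> below), so the floors only
  convert the coordinates from reals to integers.
\<close>

definition linear_form :: "real^3 \<Rightarrow> 3 int_poly" where
  "linear_form v = (\<Sum>i\<in>UNIV. of_int \<lfloor>v $ i\<rfloor> * var i)"

definition G2_edge :: "(real^3 \<Rightarrow> real^3) \<Rightarrow> (real^3 \<Rightarrow> real^3) \<Rightarrow> real^3 \<Rightarrow> bool" where
  "G2_edge w w' \<alpha> \<longleftrightarrow>
     w \<in> W_G2 \<and> w' \<in> W_G2 \<and> \<alpha> \<in> G2_roots \<and> w = w' \<circ> reflection \<alpha>"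

definition G2_label :: "(real^3 \<Rightarrow> real^3) \<Rightarrow> real^3 \<Rightarrow> 3 int_poly" where
  "G2_label w \<alpha> = linear_form (w \<alpha>)"

text \<open>
  Maps $W(G_2)\to\mathbf{Z}[t_1,t_2,t_3]$ are represented by functions that are \<open>undefined\<close>
  outside \<open>W_G2\<close>.
\<close>

definition HT_G2 :: "((real^3 \<Rightarrow> real^3) \<Rightarrow> 3 int_poly) ring" where
  "HT_G2 = \<lparr>
     carrier = {h \<in> extensional W_G2. \<forall>w w' \<alpha>. G2_edge w w' \<alpha> \<longrightarrow> G2_label w \<alpha> dvd h w - h w'},
     monoid.mult = (\<lambda>h k. \<lambda>w\<in>W_G2. h w * k w),
     one = (\<lambda>w\<in>W_G2. 1),
     ring.zero = (\<lambda>w\<in>W_G2. 0),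
     add = (\<lambda>h k. \<lambda>w\<in>W_G2. h w + k w)\<rparr>"


section \<open>Identification of the vertex set with signed permutations\<close>

text \<open>\<open>S\<^sub>3\<close> is \<open>BijGroup (UNIV :: 3 set)\<close>. Existence and uniqueness of the isomorphism are
  proved in \<open>psi_ex1\<close>.\<close>

definition is_psi :: "((real^3 \<Rightarrow> real^3) \<Rightarrow> (3 \<Rightarrow> 3)) \<Rightarrow> bool" where
  "is_psi \<psi> \<longleftrightarrow>
     \<psi> \<in> iso (weyl_group long_roots) (BijGroup UNIV) \<and> \<psi> \<in> extensional W_long \<and>
     (\<forall>i j. i \<noteq> j \<longrightarrow> \<psi> (reflection (s_vec i - s_vec j)) = Transposition.transpose i j)"

definition psi :: "(real^3 \<Rightarrow> real^3) \<Rightarrow> (3 \<Rightarrow> 3)" where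
  "psi = (THE \<psi>. is_psi \<psi>)"

definition rho :: "real^3 \<Rightarrow> real^3" where
  "rho = (reflection (s_vec 1) \<circ> reflection (s_vec 3 - s_vec 1)) ^^ 3"

text \<open>The signs \<open>+\<close> and \<open>-\<close> are the integers \<open>1\<close> and \<open>-1\<close>. The lemmas \<open>vertex_long\<close>,
  \<open>vertex_rho\<close> and \<open>bij_betw_vertex\<close> below show that this is the intended bijection.\<close>

definition vertex :: "(real^3 \<Rightarrow> real^3) \<Rightarrow> (3 \<Rightarrow> 3) \<times> int" where
  "vertex w = (if w \<in> W_long then (psi w, 1) else (psi (inv_into UNIV rho \<circ> w), - 1))"


section \<open>The generators, the canonical homomorphism and the relations\<close>

definition s_poly :: "3 \<Rightarrow> 3 int_poly" where
  "s_poly = s_of var"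

definition tau_class :: "3 \<Rightarrow> (real^3 \<Rightarrow> real^3) \<Rightarrow> 3 int_poly" where
  "tau_class i = (\<lambda>w\<in>W_G2. case vertex w of (v, \<epsilon>) \<Rightarrow> of_int \<epsilon> * s_poly (v i))"

definition t_class :: "3 \<Rightarrow> (real^3 \<Rightarrow> real^3) \<Rightarrow> 3 int_poly" where
  "t_class i = (\<lambda>w\<in>W_G2. var i)"

definition f_class :: "(real^3 \<Rightarrow> real^3) \<Rightarrow> 3 int_poly" where
  "f_class = (\<lambda>w\<in>W_G2. case vertex w of (v, \<epsilon>) \<Rightarrow>
     if \<epsilon> = 1 then s_poly 1 * s_poly 2 * s_poly 3 else 0)"

datatype gen = Tau "3" | Tvar "3" | Fvar

fun gen_class :: "gen \<Rightarrow> (real^3 \<Rightarrow> real^3) \<Rightarrow> 3 int_poly" where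
  "gen_class (Tau i) = tau_class i"
| "gen_class (Tvar i) = t_class i"
| "gen_class Fvar = f_class"

definition gen_ring :: "gen int_poly ring" where
  "gen_ring = \<lparr>carrier = UNIV, monoid.mult = (*), one = 1, ring.zero = 0, add = (+)\<rparr>"

definition canonical_hom :: "gen int_poly \<Rightarrow> (real^3 \<Rightarrow> real^3) \<Rightarrow> 3 int_poly" where
  "canonical_hom p = (\<lambda>w\<in>W_G2. poly_eval (\<lambda>x. gen_class x w) p)"

definition G2_relations :: "gen int_poly set" where
  "G2_relations =
     (let \<tau> = (\<lambda>i. var (Tau i)); s = s_of (\<lambda>i. var (Tvar i)); f = var Fvar
      in {elem_sym 1 \<tau>,
          elem_sym 2 \<tau> - elem_sym 2 s,
          2 * f - elem_sym 3 \<tau> - elem_sym 3 s,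
          f ^ 2 - f * elem_sym 3 s})"

section \<open>Well-definedness\<close>

text \<open>
  \<open>acts_by w v e\<close>: the linear map \<open>w\<close> fixes $t_1+t_2+t_3$ and sends \<open>s\<^sub>i\<close> to \<open>e s\<^sub>v\<^sub>(\<^sub>i\<^sub>)\<close>.
  Every element of the Weyl group is of this form for a unique \<open>(v, e)\<close>.
\<close>

definition acts_by :: "(real^3 \<Rightarrow> real^3) \<Rightarrow> (3 \<Rightarrow> 3) \<Rightarrow> int \<Rightarrow> bool" where
  "acts_by w v e \<longleftrightarrow>
     linear w \<and> w (1) = 1 \<and> bij v \<and> (\<forall>i. w (s_vec i) = of_int e *\<^sub>R s_vec (v i))"

lemma s_vec_nth:
  "s_vec 1 = vector [1, -1, 0]" "s_vec 2 = vector [0, 1, -1]" "s_vec 3 = vector [-1, 0, 1]"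
  by (simp_all add: s_vec_def s_of_def vec_eq_iff forall_3 axis_def del: num1_eq1)

lemma s_vec_inner: "s_vec i \<bullet> s_vec j = (if i = j then 2 else -1)"
  using exhaust_3[of i] exhaust_3[of j]
  by (auto simp: s_vec_nth inner_vec_def sum_3)

lemma s_vec_inner_one: "s_vec i \<bullet> 1 = 0"
  using exhaust_3[of i] by (auto simp: s_vec_nth inner_vec_def sum_3)

lemma s_vec_sum: "i \<noteq> j \<Longrightarrow> j \<noteq> k \<Longrightarrow> i \<noteq> k \<Longrightarrow> s_vec i + s_vec j + s_vec k = 0"
  using exhaust_3[of i] exhaust_3[of j] exhaust_3[of k]
  by (auto simp: s_vec_nth vec_eq_iff forall_3)

lemma s_vec_eq_iff: "s_vec i = s_vec j \<longleftrightarrow> i = j"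
  using s_vec_inner[of i i] s_vec_inner[of i j] by (auto split: if_splits)

lemma s_vec_neq_uminus: "s_vec i \<noteq> - s_vec j"
proof
  assume "s_vec i = - s_vec j"
  then have "s_vec i \<bullet> s_vec i = - (s_vec i \<bullet> s_vec j)" by simp
  then show False by (simp add: s_vec_inner split: if_splits)
qed

lemma linear_reflection: "linear (reflection \<alpha>)"
  unfolding reflection_def
  by (rule linearI) (auto simp: inner_add_right algebra_simps add_divide_distrib)

lemma reflection_invol: "reflection \<alpha> (reflection \<alpha> x) = x"
  by (cases "\<alpha> = 0") (auto simp: reflection_def inner_diff_right scaleR_left_diff_distrib field_simps)

lemma acts_by_short:
  assumes "i \<noteq> j" "j \<noteq> k" "i \<noteq> k"
  shows "acts_by (reflection (s_vec k)) (Transposition.transpose i j) (- 1)"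
proof -
  have "reflection (s_vec k) (s_vec m) = - s_vec (Transposition.transpose i j m)" for m
  proof -
    have "m = i \<or> m = j \<or> m = k"
      using assms exhaust_3[of i] exhaust_3[of j] exhaust_3[of k] exhaust_3[of m] by auto
    then show ?thesis
      using assms s_vec_sum[of i j k]
      by (auto simp: reflection_def s_vec_inner Transposition.transpose_def algebra_simps
          eq_neg_iff_add_eq_0 scaleR_2)
  qed
  moreover have "reflection (s_vec k) 1 = 1"
    by (simp add: reflection_def s_vec_inner_one)
  ultimately show ?thesis
    by (simp add: acts_by_def linear_reflection)
qed

lemma acts_by_long:
  assumes "i \<noteq> j"
  shows "acts_by (reflection (s_vec i - s_vec j)) (Transposition.transpose i j) 1"
proof -
  have "reflection (s_vec i - s_vec j) (s_vec m) = s_vec (Transposition.transpose i j m)" for m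
    using assms
    by (auto simp: reflection_def s_vec_inner Transposition.transpose_def algebra_simps)
  moreover have "reflection (s_vec i - s_vec j) 1 = 1"
    by (simp add: reflection_def s_vec_inner_one inner_diff_left)
  ultimately show ?thesis
    by (simp add: acts_by_def linear_reflection)
qed

lemma acts_by_id: "acts_by (\<lambda>x. x) (\<lambda>x. x) 1"
  by (simp add: acts_by_def linear_id[unfolded id_def] bij_id[unfolded id_def])

lemma acts_by_comp:
  assumes "acts_by w v e" "acts_by w' v' e'"
  shows "acts_by (w \<circ> w') (v \<circ> v') (e * e')"
  using assms
  by (auto simp: acts_by_def linear_compose bij_comp linear_cmul mult.commute)

lemma acts_by_det:
  assumes "acts_by w v e" "acts_by w' v e"
  shows "w = w'"
proof
  fix x :: "real^3"
  define c where "c = (x $ 1 + x $ 2 + x $ 3) / 3"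
  have x: "x = (x $ 1 - c) *\<^sub>R s_vec 1 + (c - x $ 3) *\<^sub>R s_vec 2 + c *\<^sub>R 1"
    by (simp add: vec_eq_iff forall_3 s_vec_nth c_def field_simps)
  have lin: "linear w" "linear w'" using assms by (auto simp: acts_by_def)
  show "w x = w' x"
    by (subst (1 2) x)
       (use assms in \<open>simp add: linear_add[OF lin(1)] linear_add[OF lin(2)]
          linear_cmul[OF lin(1)] linear_cmul[OF lin(2)] acts_by_def\<close>)
qed

lemma acts_by_unique:
  assumes "acts_by w v e" "acts_by w v' e'" "e = 1 \<or> e = - 1" "e' = 1 \<or> e' = - 1"
  shows "v = v' \<and> e = e'"
proof -
  have *: "of_int e *\<^sub>R s_vec (v i) = of_int e' *\<^sub>R s_vec (v' i)" for i
    using assms(1,2) unfolding acts_by_def by metis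
  have "e = e'"
    using *[of 1] assms(3,4) s_vec_neq_uminus[of "v 1" "v' 1"] s_vec_neq_uminus[of "v' 1" "v 1"]
    by auto
  with * assms(3) show ?thesis by (auto simp: s_vec_eq_iff)
qed

lemma mult_BijGroup_UNIV:
  "bij g \<Longrightarrow> bij h \<Longrightarrow> g \<otimes>\<^bsub>BijGroup UNIV\<^esub> h = g \<circ> h"
  by (simp add: BijGroup_def Bij_def compose_def comp_def fun_eq_iff)

lemma one_BijGroup_UNIV: "\<one>\<^bsub>BijGroup UNIV\<^esub> = (\<lambda>x. x)"
  by (simp add: BijGroup_def fun_eq_iff)

lemma carrier_BijGroup_UNIV: "carrier (BijGroup UNIV) = {f. bij f}"
  by (auto simp: BijGroup_def Bij_def)

lemma bij_reflection: "bij (reflection \<alpha>)"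
  by (rule o_bij[of "reflection \<alpha>"]) (auto simp: reflection_invol fun_eq_iff)

lemma reflections_in_carrier: "reflection ` R \<subseteq> carrier (BijGroup UNIV)"
  by (auto simp: carrier_BijGroup_UNIV bij_reflection)

lemma carrier_weyl: "carrier (weyl_group R) = generate (BijGroup UNIV) (reflection ` R)"
  using reflections_in_carrier[of R]
  by (simp add: weyl_group_def carrier_subgroup_generated Int_absorb1)

lemma inv_reflection: "inv\<^bsub>BijGroup UNIV\<^esub> (reflection \<alpha>) = reflection \<alpha>"
proof -
  interpret group "BijGroup (UNIV :: (real^3) set)" by (rule group_BijGroup)
  show ?thesis
    by (rule inv_equality)
       (auto simp: mult_BijGroup_UNIV one_BijGroup_UNIV carrier_BijGroup_UNIV bij_reflection
          reflection_invol fun_eq_iff)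
qed

lemma weyl_bij: "w \<in> carrier (weyl_group R) \<Longrightarrow> bij w"
  using group.generate_in_carrier[OF group_BijGroup reflections_in_carrier]
  by (auto simp: carrier_weyl carrier_BijGroup_UNIV)

lemma weyl_id: "(\<lambda>x. x) \<in> carrier (weyl_group R)"
  using generate.one[of "BijGroup UNIV" "reflection ` R"]
  by (simp add: carrier_weyl one_BijGroup_UNIV)

lemma weyl_reflection: "\<alpha> \<in> R \<Longrightarrow> reflection \<alpha> \<in> carrier (weyl_group R)"
  by (simp add: carrier_weyl generate.incl)

lemma weyl_comp:
  assumes "w \<in> carrier (weyl_group R)" "w' \<in> carrier (weyl_group R)"
  shows "w \<circ> w' \<in> carrier (weyl_group R)"
  using generate.eng[of w "BijGroup UNIV" "reflection ` R" w'] assms weyl_bij[of _ R]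
  by (simp add: carrier_weyl mult_BijGroup_UNIV)

lemma weyl_mult:
  assumes "w \<in> carrier (weyl_group R)" "w' \<in> carrier (weyl_group R)"
  shows "w \<otimes>\<^bsub>weyl_group R\<^esub> w' = w \<circ> w'"
  using assms weyl_bij[of _ R] by (simp add: weyl_group_def mult_BijGroup_UNIV)

lemma weyl_induct [consumes 1, case_names id reflection comp]:
  assumes "w \<in> carrier (weyl_group R)"
    and id: "P (\<lambda>x. x)"
    and reflection: "\<And>\<alpha>. \<alpha> \<in> R \<Longrightarrow> P (reflection \<alpha>)"
    and comp: "\<And>w w'. w \<in> carrier (weyl_group R) \<Longrightarrow> w' \<in> carrier (weyl_group R) \<Longrightarrow>
                 P w \<Longrightarrow> P w' \<Longrightarrow> P (w \<circ> w')"
  shows "P w"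
proof -
  have "w \<in> generate (BijGroup UNIV) (reflection ` R)"
    using assms(1) by (simp add: carrier_weyl)
  then show ?thesis
  proof induction
    case one
    then show ?case using id by (simp add: one_BijGroup_UNIV)
  next
    case (incl h)
    then show ?case using reflection by auto
  next
    case (inv h)
    then show ?case using reflection by (auto simp: inv_reflection)
  next
    case (eng h1 h2)
    then have "h1 \<in> carrier (weyl_group R)" "h2 \<in> carrier (weyl_group R)"
      by (simp_all add: carrier_weyl)
    then show ?case using comp[of h1 h2] eng.IH weyl_bij[of _ R]
      by (simp only: mult_BijGroup_UNIV)
  qed
qed

lemma long_roots_subset: "long_roots \<subseteq> G2_roots"
  by (auto simp: G2_roots_def)

lemma W_long_subset: "W_long \<subseteq> W_G2"
proof
  fix w assume "w \<in> W_long"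
  then show "w \<in> W_G2"
  proof (induction rule: weyl_induct)
    case (reflection \<alpha>)
    then show ?case using long_roots_subset by (auto intro: weyl_reflection)
  qed (rule weyl_id, rule weyl_comp)
qed

lemma W_long_acts: "w \<in> W_long \<Longrightarrow> \<exists>v. acts_by w v 1"
proof (induction rule: weyl_induct)
  case id
  then show ?case using acts_by_id by blast
next
  case (reflection \<alpha>)
  then obtain i j where "i \<noteq> j" "\<alpha> = s_vec i - s_vec j" by (auto simp: long_roots_def)
  then show ?case using acts_by_long by blast
next
  case (comp w w')
  then obtain v v' where "acts_by w v 1" "acts_by w' v' 1" by blast
  from acts_by_comp[OF this] show ?case by (simp only: mult_1_left) (rule exI)
qed

lemma reflection_uminus: "reflection (- \<alpha>) = reflection \<alpha>"
  by (simp add: reflection_def fun_eq_iff)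

lemma W_G2_acts: "w \<in> W_G2 \<Longrightarrow> \<exists>v e. acts_by w v e \<and> (e = 1 \<or> e = - 1)"
proof (induction rule: weyl_induct)
  case id
  then show ?case using acts_by_id by blast
next
  case (reflection \<alpha>)
  have "\<exists>v e. acts_by (reflection (s_vec k)) v e \<and> (e = 1 \<or> e = - 1)" for k
  proof -
    have "acts_by (reflection (s_vec 1)) (Transposition.transpose 2 3) (- 1)"
      "acts_by (reflection (s_vec 2)) (Transposition.transpose 1 3) (- 1)"
      "acts_by (reflection (s_vec 3)) (Transposition.transpose 1 2) (- 1)"
      by (simp_all add: acts_by_short)
    then show ?thesis using exhaust_3[of k] by blast
  qed
  moreover have "\<exists>v e. acts_by (reflection \<beta>) v e \<and> (e = 1 \<or> e = - 1)" if \<beta>: "\<beta> \<in> long_roots" for \<beta>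
  proof -
    obtain i j where "i \<noteq> j" "\<beta> = s_vec i - s_vec j"
      using \<beta> unfolding long_roots_def by blast
    then show ?thesis using acts_by_long by blast
  qed
  ultimately show ?case
    using reflection by (auto simp: G2_roots_def reflection_uminus)
next
  case (comp w w')
  then obtain v e v' e' where *: "acts_by w v e" "e = 1 \<or> e = - 1"
    "acts_by w' v' e'" "e' = 1 \<or> e' = - 1" by blast
  have "e * e' = 1 \<or> e * e' = - 1" using *(2,4) by auto
  with acts_by_comp[OF *(1,3)] show ?case by blast
qed

lemma W_long_surj:
  assumes "bij v"
  shows "\<exists>w\<in>W_long. acts_by w v 1"
proof -
  have "v permutes UNIV" using assms by (simp add: permutes_def bij_iff)
  then show ?thesis using finite_class.finite_UNIV
  proof (induction rule: permutes_induct)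
    case id
    then show ?case using weyl_id acts_by_id by (auto simp: id_def)
  next
    case (swap a b p)
    then obtain w where w: "w \<in> W_long" "acts_by w p 1" by blast
    have "s_vec a - s_vec b \<in> long_roots" using \<open>a \<noteq> b\<close> by (auto simp: long_roots_def)
    then have "reflection (s_vec a - s_vec b) \<circ> w \<in> W_long"
      using w(1) by (intro weyl_comp weyl_reflection)
    moreover have "acts_by (reflection (s_vec a - s_vec b) \<circ> w) (Transposition.transpose a b \<circ> p) 1"
      using acts_by_comp[OF acts_by_long[OF \<open>a \<noteq> b\<close>] w(2)] by (simp only: mult_1_left)
    ultimately show ?case by blast
  qed
qed

lemma weyl_root:
  assumes "w \<in> W_G2" "\<alpha> \<in> G2_roots"
  shows "w \<alpha> \<in> G2_roots"
proof -
  obtain v e where *: "acts_by w v e" "e = 1 \<or> e = - 1" using W_G2_acts[OF assms(1)] by blast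
  have lin: "linear w" and s: "w (s_vec i) = of_int e *\<^sub>R s_vec (v i)" for i
    using *(1) by (auto simp: acts_by_def)
  have inj: "v i \<noteq> v j" if "i \<noteq> j" for i j
    using *(1) that by (auto simp: acts_by_def bij_def dest: injD)
  from assms(2) consider k where "\<alpha> = s_vec k" | k where "\<alpha> = - s_vec k"
    | i j where "\<alpha> = s_vec i - s_vec j" "i \<noteq> j"
    by (auto simp: G2_roots_def long_roots_def)
  then show ?thesis
  proof cases
    case 3
    have "w \<alpha> = of_int e *\<^sub>R (s_vec (v i) - s_vec (v j))"
      unfolding 3(1) linear_diff[OF lin] s scaleR_right_diff_distrib ..
    then have "w \<alpha> = s_vec (v i) - s_vec (v j) \<or> w \<alpha> = s_vec (v j) - s_vec (v i)"
      using *(2) by auto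
    moreover have "s_vec (v i) - s_vec (v j) \<in> long_roots" "s_vec (v j) - s_vec (v i) \<in> long_roots"
      using inj[OF 3(2)] inj[OF 3(2)[symmetric]] unfolding long_roots_def by blast+
    ultimately show ?thesis using long_roots_subset by auto
  qed (use *(2) in \<open>auto simp: G2_roots_def linear_neg[OF lin] s\<close>)
qed

lemma s_vec_integral: "s_vec i $ k \<in> \<int>"
  using exhaust_3[of i] exhaust_3[of k] by (auto simp: s_vec_nth)

lemma root_integral: "\<alpha> \<in> G2_roots \<Longrightarrow> \<alpha> $ k \<in> \<int>"
  by (auto simp: G2_roots_def long_roots_def s_vec_integral intro!: Ints_diff)

lemma psi_acts:
  assumes "is_psi \<psi>" "w \<in> W_long"
  shows "acts_by w (\<psi> w) 1"
proof -
  have hom: "\<psi> \<in> hom (weyl_group long_roots) (BijGroup UNIV)"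
    using assms(1) by (simp add: is_psi_def iso_def)
  have bij: "bij (\<psi> w)" if "w \<in> W_long" for w
    using hom_in_carrier[OF hom that] by (simp add: carrier_BijGroup_UNIV)
  have mult: "\<psi> (w \<circ> w') = \<psi> w \<circ> \<psi> w'" if "w \<in> W_long" "w' \<in> W_long" for w w'
    using hom_mult[OF hom that] that bij by (simp add: weyl_mult mult_BijGroup_UNIV)
  show ?thesis
    using assms(2)
  proof (induction rule: weyl_induct)
    case id
    have "\<psi> (\<lambda>x. x) = \<psi> (\<lambda>x. x) \<circ> \<psi> (\<lambda>x. x)"
      using mult[OF weyl_id weyl_id] by (simp add: comp_def)
    then have "\<psi> (\<lambda>x. x) = (\<lambda>x. x)"
      using bij[OF weyl_id] by (metis bij_def comp_apply ext injD)
    then show ?case using acts_by_id by simp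
  next
    case (reflection \<alpha>)
    then obtain i j where "i \<noteq> j" "\<alpha> = s_vec i - s_vec j" by (auto simp: long_roots_def)
    then show ?case using assms(1) acts_by_long by (simp add: is_psi_def)
  next
    case (comp w w')
    from acts_by_comp[OF comp.IH] show ?case
      unfolding mult[OF comp.hyps] by (simp only: mult_1_left)
  qed
qed

lemma psi_ex1: "\<exists>!\<psi>. is_psi \<psi>"
proof (rule ex_ex1I)
  define \<psi> where "\<psi> = restrict (\<lambda>w. THE v. acts_by w v 1) W_long"
  have val: "\<psi> w = v" if "w \<in> W_long" "acts_by w v 1" for w v
    using that acts_by_unique[of w _ 1 _ 1] unfolding \<psi>_def by (auto intro!: the_equality)
  have acts: "acts_by w (\<psi> w) 1" if "w \<in> W_long" for w
    using W_long_acts[OF that] val[OF that] by auto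
  have bij: "bij (\<psi> w)" if "w \<in> W_long" for w
    using acts[OF that] by (simp add: acts_by_def)
  have "\<psi> (w \<circ> w') = \<psi> w \<circ> \<psi> w'" if "w \<in> W_long" "w' \<in> W_long" for w w'
    using acts_by_comp[OF acts[OF that(1)] acts[OF that(2)]] that by (auto intro!: val weyl_comp)
  then have "\<psi> \<in> hom (weyl_group long_roots) (BijGroup UNIV)"
    by (auto simp: hom_def carrier_BijGroup_UNIV bij weyl_mult mult_BijGroup_UNIV)
  moreover have "inj_on \<psi> W_long"
    using acts by (metis acts_by_det inj_onI)
  moreover have "\<psi> ` W_long = {v. bij v}"
    using bij W_long_surj val by (auto simp: image_iff) metis
  moreover have "\<psi> (reflection (s_vec i - s_vec j)) = Transposition.transpose i j" if "i \<noteq> j" for i j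
    using that by (intro val acts_by_long weyl_reflection) (auto simp: long_roots_def)
  ultimately have "is_psi \<psi>"
    by (auto simp: is_psi_def iso_def bij_betw_def carrier_BijGroup_UNIV \<psi>_def)
  then show "\<exists>\<psi>. is_psi \<psi>" by blast
next
  fix \<psi> \<psi>'
  assume *: "is_psi \<psi>" "is_psi \<psi>'"
  show "\<psi> = \<psi>'"
  proof (rule extensionalityI)
    show "\<psi> \<in> extensional W_long" "\<psi>' \<in> extensional W_long" using * by (auto simp: is_psi_def)
    fix w assume "w \<in> W_long"
    then show "\<psi> w = \<psi>' w"
      using psi_acts[OF *(1)] psi_acts[OF *(2)] acts_by_unique by blast
  qed
qed

lemma is_psi_psi: "is_psi psi"
  unfolding psi_def by (rule theI'[OF psi_ex1])

lemma acts_by_rho: "acts_by rho (\<lambda>x. x) (- 1)"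
proof -
  define p where "p = (Transposition.transpose 2 3 \<circ> Transposition.transpose 3 1 :: 3 \<Rightarrow> 3)"
  have "acts_by (reflection (s_vec 1) \<circ> reflection (s_vec 3 - s_vec 1)) p (- 1 * 1)"
    unfolding p_def by (intro acts_by_comp acts_by_short acts_by_long) simp_all
  from acts_by_comp[OF this acts_by_comp[OF this this]]
  have "acts_by rho (p \<circ> (p \<circ> p)) (- 1)"
    by (simp add: rho_def numeral_3_eq_3 comp_assoc)
  moreover have "p \<circ> (p \<circ> p) = (\<lambda>x. x)"
    by (simp add: fun_eq_iff forall_3 p_def Transposition.transpose_def)
  ultimately show ?thesis by simp
qed

lemma rho_invol: "rho \<circ> rho = (\<lambda>x. x)"
proof -
  have "(\<lambda>x. x) \<circ> (\<lambda>x. x) = (\<lambda>x::3. x)" by (simp add: fun_eq_iff)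
  with acts_by_comp[OF acts_by_rho acts_by_rho] have "acts_by (rho \<circ> rho) (\<lambda>x. x) 1" by simp
  from acts_by_det[OF this acts_by_id] show ?thesis .
qed

lemma inv_rho: "inv_into UNIV rho = rho"
  using inv_unique_comp[of rho rho] rho_invol unfolding id_def by blast

lemma rho_in_W: "rho \<in> W_G2"
proof -
  let ?g = "reflection (s_vec 1) \<circ> reflection (s_vec 3 - s_vec 1)"
  have "(3::3) \<noteq> 1" by simp
  then have "s_vec 3 - s_vec 1 \<in> G2_roots"
    unfolding G2_roots_def long_roots_def by blast
  moreover have "s_vec 1 \<in> G2_roots" by (simp add: G2_roots_def)
  ultimately have "?g \<in> W_G2" by (intro weyl_comp weyl_reflection)
  from weyl_comp[OF this weyl_comp[OF this this]]
  have "?g \<circ> (?g \<circ> ?g) \<in> W_G2" .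
  then show ?thesis by (simp add: rho_def numeral_3_eq_3 comp_assoc)
qed

lemma acts_by_rho_comp: "acts_by w v 1 \<Longrightarrow> acts_by (rho \<circ> w) v (- 1)"
  using acts_by_comp[OF acts_by_rho, of w v 1] by (simp add: comp_def)

lemma rho_comp_notin_W_long:
  assumes "w \<in> W_long"
  shows "rho \<circ> w \<notin> W_long"
proof
  assume "rho \<circ> w \<in> W_long"
  then obtain v where v: "acts_by (rho \<circ> w) v 1" using W_long_acts by blast
  obtain v' where "acts_by w v' 1" using W_long_acts[OF assms] by blast
  from acts_by_unique[OF v acts_by_rho_comp[OF this]] show False by simp
qed

lemma W_G2_decomp: "W_G2 = W_long \<union> (\<lambda>w. rho \<circ> w) ` W_long"
proof
  show "W_long \<union> (\<lambda>w. rho \<circ> w) ` W_long \<subseteq> W_G2"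
    using W_long_subset rho_in_W by (auto intro!: weyl_comp)
  show "W_G2 \<subseteq> W_long \<union> (\<lambda>w. rho \<circ> w) ` W_long"
  proof
    fix w assume "w \<in> W_G2"
    then obtain v e where *: "acts_by w v e" "e = 1 \<or> e = - 1" using W_G2_acts by blast
    then obtain w' where w': "w' \<in> W_long" "acts_by w' v 1"
      using W_long_surj[of v] by (auto simp: acts_by_def)
    show "w \<in> W_long \<union> (\<lambda>w. rho \<circ> w) ` W_long"
    proof (cases "e = 1")
      case True
      then show ?thesis using acts_by_det[of w v 1 w'] * w' by auto
    next
      case False
      then have "acts_by (rho \<circ> w') v e"
        using acts_by_rho_comp[OF w'(2)] *(2) by auto
      then have "w = rho \<circ> w'" using acts_by_det *(1) by blast
      then show ?thesis using w'(1) by blast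
    qed
  qed
qed

lemma vertex_long: "w \<in> W_long \<Longrightarrow> vertex w = (psi w, 1)"
  by (simp add: vertex_def)

lemma vertex_rho: "w \<in> W_long \<Longrightarrow> vertex (rho \<circ> w) = (psi w, - 1)"
proof -
  assume w: "w \<in> W_long"
  have "rho \<circ> (rho \<circ> w) = w"
    using rho_invol by (simp add: fun_eq_iff)
  then show ?thesis
    using w by (simp add: vertex_def rho_comp_notin_W_long inv_rho)
qed

lemma bij_betw_vertex: "bij_betw vertex W_G2 ({v. bij v} \<times> {1, - 1})"
proof -
  have psi: "bij_betw psi W_long {v. bij v}"
    using is_psi_psi by (simp add: is_psi_def iso_def carrier_BijGroup_UNIV)
  have long: "vertex ` W_long = {v. bij v} \<times> {1}"
  proof -
    have "vertex ` W_long = (\<lambda>v. (v, 1)) ` psi ` W_long"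
      unfolding image_image by (rule image_cong) (simp_all add: vertex_long)
    then show ?thesis using psi by (auto simp: bij_betw_def)
  qed
  have rho: "vertex ` (\<lambda>w. rho \<circ> w) ` W_long = {v. bij v} \<times> {- 1}"
  proof -
    have "vertex ` (\<lambda>w. rho \<circ> w) ` W_long = (\<lambda>v. (v, - 1)) ` psi ` W_long"
      unfolding image_image by (rule image_cong) (simp_all add: vertex_rho)
    then show ?thesis using psi by (auto simp: bij_betw_def)
  qed
  have "inj_on vertex W_G2"
  proof (rule inj_onI)
    fix w w' assume w: "w \<in> W_G2" "w' \<in> W_G2" and eq: "vertex w = vertex w'"
    have inj: "u = u'" if "u \<in> W_long" "u' \<in> W_long" "psi u = psi u'" for u u'
      using psi that by (auto simp: bij_betw_def dest: inj_onD)
    from w consider "w \<in> W_long" "w' \<in> W_long"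
      | u where "w \<in> W_long" "u \<in> W_long" "w' = rho \<circ> u"
      | u where "u \<in> W_long" "w = rho \<circ> u" "w' \<in> W_long"
      | u u' where "u \<in> W_long" "w = rho \<circ> u" "u' \<in> W_long" "w' = rho \<circ> u'"
      unfolding W_G2_decomp by blast
    then show "w = w'"
    proof cases
      case 1
      then show ?thesis using eq inj by (simp add: vertex_long)
    next
      case 2
      then show ?thesis using eq by (simp add: vertex_long vertex_rho)
    next
      case 3
      then show ?thesis using eq by (simp add: vertex_long vertex_rho)
    next
      case 4
      then have "psi u = psi u'" using eq by (simp add: vertex_rho)
      then show ?thesis using 4 inj by blast
    qed
  qed
  moreover have "vertex ` W_G2 = {v. bij v} \<times> {1, - 1}"
    unfolding W_G2_decomp image_Un long rho by auto
  ultimately show ?thesis by (simp add: bij_betw_def)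
qed

lemma cring_gen_ring: "cring gen_ring"
  by unfold_locales
     (auto simp: gen_ring_def algebra_simps Units_def intro: exI[of _ "- _"] add.right_inverse)

lemma cring_HT_G2: "cring HT_G2"
proof -
  let ?A = "carrier HT_G2"
  have mem: "h \<in> ?A \<longleftrightarrow> h \<in> extensional W_G2 \<and>
      (\<forall>w w' \<alpha>. G2_edge w w' \<alpha> \<longrightarrow> G2_label w \<alpha> dvd h w - h w')" for h
    by (simp add: HT_G2_def)
  have edge: "w \<in> W_G2" "w' \<in> W_G2" if "G2_edge w w' \<alpha>" for w w' \<alpha>
    using that unfolding G2_edge_def by blast+
  have ring_hom: "h w * k w - h w' * k w' = (h w - h w') * k w + h w' * (k w - k w')"
    for h k :: "(real^3 \<Rightarrow> real^3) \<Rightarrow> 3 int_poly" and w w' by (simp add: algebra_simps)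
  have add: "(\<lambda>w\<in>W_G2. h w + k w) \<in> ?A" if "h \<in> ?A" "k \<in> ?A" for h k
    using that by (auto simp: mem edge add_diff_add)
  have mult: "(\<lambda>w\<in>W_G2. h w * k w) \<in> ?A" if "h \<in> ?A" "k \<in> ?A" for h k
    using that by (auto simp: mem edge ring_hom[of h _ k])
  have neg: "(\<lambda>w\<in>W_G2. - h w) \<in> ?A" if "h \<in> ?A" for h
    using that by (auto simp: mem edge dvd_minus_iff) (metis dvd_minus_iff minus_diff_eq)
  have const: "(\<lambda>w\<in>W_G2. c) \<in> ?A" for c
    by (auto simp: mem edge)
  have ext: "(\<lambda>w\<in>W_G2. h w) = h" if "h \<in> ?A" for h
    using that by (simp add: mem extensional_restrict)
  show ?thesis
  proof (rule cringI)
    show "abelian_group HT_G2"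
    proof (rule abelian_groupI)
      fix h assume h: "h \<in> ?A"
      show "\<exists>k\<in>?A. k \<oplus>\<^bsub>HT_G2\<^esub> h = \<zero>\<^bsub>HT_G2\<^esub>"
        by (rule bexI[OF _ neg[OF h]]) (auto simp: HT_G2_def fun_eq_iff)
      show "\<zero>\<^bsub>HT_G2\<^esub> \<oplus>\<^bsub>HT_G2\<^esub> h = h"
        using ext[OF h] by (simp add: HT_G2_def cong: restrict_cong)
    qed (use add const in \<open>auto simp: HT_G2_def algebra_simps fun_eq_iff\<close>)
    show "Group.comm_monoid HT_G2"
    proof (rule comm_monoidI)
      fix h assume h: "h \<in> ?A"
      show "\<one>\<^bsub>HT_G2\<^esub> \<otimes>\<^bsub>HT_G2\<^esub> h = h"
        using ext[OF h] by (simp add: HT_G2_def cong: restrict_cong)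
    qed (use mult const in \<open>auto simp: HT_G2_def algebra_simps fun_eq_iff\<close>)
  qed (auto simp: HT_G2_def algebra_simps fun_eq_iff)
qed

end

theory Submission
  imports Defs "HOL-Computational_Algebra.Factorial_Ring"
begin

text \<open>
  Under the identification of the vertices with the pairs $(v,\varepsilon)$, the edges are of two
  kinds. Reflections in the roots $s_i-s_j$ join $(v,\varepsilon)$ to $(v(i\,j),\varepsilon)$ with label
  $\pm(s_{v(i)}-s_{v(j)})$, so they make each of the halves $\varepsilon=\pm$ a copy of the graph of the
  flag manifold of type $A_2$ with roots $s_i-s_j$. Reflections in $\pm s_k$ cross from one half
  to the other, from $(v,\varepsilon)$ to $(v(i\,j),-\varepsilon)$, with label $\pm s_{v(k)}$. A polynomial in
  the seven generators is evaluated at $(v,\varepsilon)$ by \<open>gen_value v \<epsilon>\<close>, and all conditions are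
  checked on these values.

  Surjectivity. The theorem rests on the $A_2$ case: by \<open>A2_interpolation\<close>, a function
  on the six permutations that satisfies the divisibility conditions is a polynomial over
  $\mathbf{Z}[t]$ in $\tau_1,\tau_2$. This is triangular elimination in a basis of double Schubert
  polynomials. Given a class $h$, choose such a polynomial $p$ that agrees with $h$ on
  the half $\varepsilon=-$. Then $h-p$ vanishes there, so the crossing edges make its value at
  each $(v,+)$ divisible by $s_1$, $s_2$ and $s_3$, hence by $e_3(s)=s_1s_2s_3$, the value of
  $f$. The quotient again satisfies the $A_2$ conditions, because $s_i-s_j$ is prime and does
  not divide $e_3(s)$. It is therefore a polynomial $q$ in $\tau_1,\tau_2$, and $h=p+fq$. The
  divisibility arguments use that the roots are primes of $\mathbf{Z}[t]$, no two of which divide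
  each other unless they are equal up to sign.

  Kernel. The relations hold at every vertex, where $e_k(\tau)=\varepsilon^k e_k(s)$. Conversely, they
  eliminate $\tau_3$, $\tau_2^2$, $\tau_1^3$ and $f^2$, so that modulo the ideal every polynomial is a
  $\mathbf{Z}[t]$-combination of the twelve monomials $\tau_1^a\tau_2^bf^d$ with $a<3$ and $b,d<2$
  (\<open>in_basis_span_all\<close>). These are linearly independent as functions on the twelve vertices
  (\<open>basis_independent\<close>): the half $\varepsilon=-$, where $f=0$, kills the coefficients with $d=0$, and
  then the half $\varepsilon=+$ kills the others. Hence a polynomial in the kernel lies in the ideal.
\<close>

section \<open>Evaluation of integer polynomials\<close>

lemma int_poly_monom_induct [case_names zero monom diff]:
  fixes p :: "'x int_poly"
  assumes "P 0" "\<And>m. P (frag_of m)" "\<And>p q. P p \<Longrightarrow> P q \<Longrightarrow> P (p - q)"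
  shows "P p"
  using frag_induction[OF subset_UNIV, of P p] assms by blast

text \<open>
  The inner product in \<open>poly_eval\<close>. It is a homomorphism from exponent vectors to
  the multiplicative monoid, from which the multiplicativity of \<open>poly_eval\<close> follows by bilinearity.
\<close>

definition monom_eval :: "('x \<Rightarrow> 'r::comm_ring_1) \<Rightarrow> ('x \<Rightarrow>\<^sub>0 nat) \<Rightarrow> 'r" where
  "monom_eval g m = (\<Prod>x\<in>Poly_Mapping.keys m. g x ^ Poly_Mapping.lookup m x)"

text \<open>
  Enlarging the index set lets two monomials be compared over the same set of variables.
\<close>

lemma monom_eval_superset:
  assumes "finite K" "Poly_Mapping.keys m \<subseteq> K"
  shows "monom_eval g m = (\<Prod>x\<in>K. g x ^ Poly_Mapping.lookup m x)"
  unfolding monom_eval_def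
  using assms by (intro prod.mono_neutral_left) (auto simp: in_keys_iff)

lemma monom_eval_add: "monom_eval g (m + n) = monom_eval g m * monom_eval g n"
proof -
  let ?K = "Poly_Mapping.keys m \<union> Poly_Mapping.keys n"
  have "Poly_Mapping.keys (m + n) \<subseteq> ?K" by (rule keys_add)
  then show ?thesis
    by (simp add: monom_eval_superset[of ?K] lookup_add power_add prod.distrib)
qed

lemma monom_eval_zero [simp]: "monom_eval g 0 = 1"
  by (simp add: monom_eval_def)

lemma poly_eval_superset:
  assumes "finite K" "Poly_Mapping.keys p \<subseteq> K"
  shows "poly_eval g p = (\<Sum>m\<in>K. of_int (Poly_Mapping.lookup p m) * monom_eval g m)"
  unfolding poly_eval_def monom_eval_def[symmetric]
  using assms by (intro sum.mono_neutral_left) (auto simp: in_keys_iff)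

lemma poly_eval_diff: "poly_eval g (p - q) = poly_eval g p - poly_eval g q"
proof -
  let ?K = "Poly_Mapping.keys p \<union> Poly_Mapping.keys q"
  have "Poly_Mapping.keys (p - q) \<subseteq> ?K" by (rule keys_diff)
  then show ?thesis
    by (simp add: poly_eval_superset[of ?K] lookup_minus algebra_simps sum_subtractf)
qed

lemma poly_eval_zero [simp]: "poly_eval g 0 = 0"
  by (simp add: poly_eval_def)

lemma poly_eval_monom: "poly_eval g (frag_of m) = monom_eval g m"
  by (simp add: poly_eval_def monom_eval_def keys_frag_of)

lemma poly_eval_one [simp]: "poly_eval g 1 = 1"
  using poly_eval_monom[of g 0] by simp

lemma poly_eval_var [simp]: "poly_eval g (var x) = g x"
  by (simp add: var_def poly_eval_monom monom_eval_def)

lemma poly_eval_add: "poly_eval g (p + q) = poly_eval g p + poly_eval g q"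
  using poly_eval_diff[of g "p + q" q] by simp

lemma poly_eval_minus: "poly_eval g (- p) = - poly_eval g p"
  using poly_eval_diff[of g 0 p] by simp

lemma poly_eval_mult: "poly_eval g (p * q) = poly_eval g p * poly_eval g q"
proof (induction p rule: int_poly_monom_induct)
  case (monom m)
  show ?case
  proof (induction q rule: int_poly_monom_induct)
    case (monom n)
    then show ?case
      by (simp add: mult_single poly_eval_monom monom_eval_add)
  qed (auto simp: poly_eval_diff algebra_simps)
qed (auto simp: poly_eval_diff algebra_simps)

lemma poly_eval_power: "poly_eval g (p ^ n) = poly_eval g p ^ n"
  by (induction n) (simp_all add: poly_eval_mult)

lemma poly_eval_of_int: "poly_eval g (of_int k) = of_int k"
proof -
  have "poly_eval g (of_nat n) = of_nat n" for n
    by (induction n) (simp_all add: poly_eval_add)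
  then show ?thesis
    by (cases k rule: int_cases2) (simp_all add: poly_eval_minus)
qed

lemma poly_eval_numeral [simp]: "poly_eval g (numeral k) = numeral k"
  using poly_eval_of_int[of g "numeral k"] by simp

lemma poly_eval_sum: "poly_eval g (sum p A) = (\<Sum>a\<in>A. poly_eval g (p a))"
  by (induction A rule: infinite_finite_induct) (simp_all add: poly_eval_add)

lemmas poly_eval_simps =
  poly_eval_add poly_eval_diff poly_eval_minus poly_eval_mult poly_eval_power poly_eval_sum

text \<open>
  Monomials arise from 1 by multiplication with variables, and every polynomial is an iterated
  difference of monomials, so a property need not be checked on sums and integer multiples.
\<close>

lemma int_poly_induct [case_names one diff var_mult]:
  fixes p :: "'x int_poly"
  assumes one: "P 1"
    and diff: "\<And>p q. P p \<Longrightarrow> P q \<Longrightarrow> P (p - q)"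
    and var_mult: "\<And>x p. P p \<Longrightarrow> P (var x * p)"
  shows "P p"
proof (induction p rule: int_poly_monom_induct)
  case (monom m)
  show ?case
  proof (induction m rule: update_induct)
    case const
    then show ?case using one by simp
  next
    case (update m x k)
    have "Poly_Mapping.update x k m = Poly_Mapping.single x k + m"
      using update.hyps
      by (intro poly_mapping_eqI) (auto simp: lookup_update lookup_add lookup_single in_keys_iff when_def)
    moreover have "P (frag_of (Poly_Mapping.single x k + m))" for k
    proof (induction k)
      case (Suc k)
      have "frag_of (Poly_Mapping.single x (Suc k) + m)
          = var x * frag_of (Poly_Mapping.single x k + m)"
        by (simp add: var_def mult_single single_add[symmetric] add.assoc[symmetric])
      with var_mult[OF Suc] show ?case by simp
    qed (use update in simp)
    ultimately show ?case by simp
  qed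
qed (use diff[OF one one] diff in auto)

lemma poly_eval_compose: "poly_eval g (poly_eval k p) = poly_eval (\<lambda>x. poly_eval g (k x)) p"
  by (induction p rule: int_poly_induct) (simp_all add: poly_eval_simps)

lemma poly_eval_var_id: "poly_eval var p = p"
  by (induction p rule: int_poly_induct) (simp_all add: poly_eval_simps)

text \<open>
  Polynomial maps respect congruences modulo \<open>d\<close>. With the label of an edge as \<open>d\<close> this
  carries the edge conditions from the generators to all polynomials in them; with a linear form
  as \<open>d\<close> it describes the multiples of that form.
\<close>

lemma dvd_poly_eval_diff:
  assumes "\<And>x. d dvd g x - k x"
  shows "d dvd poly_eval g p - poly_eval k p"
proof (induction p rule: int_poly_induct)
  case (diff p q)
  then show ?case
    using dvd_diff[OF diff] by (simp add: poly_eval_simps algebra_simps)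
next
  case (var_mult x p)
  have "d dvd (g x - k x) * poly_eval g p + k x * (poly_eval g p - poly_eval k p)"
    using assms var_mult by (intro dvd_add dvd_mult dvd_mult2)
  then show ?case by (simp add: poly_eval_simps algebra_simps)
qed simp

section \<open>Elementary symmetric polynomials in three variables\<close>

lemma elem_sym_1: "elem_sym 1 x = x 1 + x 2 + x 3"
 and elem_sym_2: "elem_sym 2 x = x 1 * x 2 + x 2 * x 3 + x 3 * x 1"
 and elem_sym_3: "elem_sym 3 x = x 1 * x 2 * x 3"
proof -
  have "{A :: 3 set. card A = 1} = {{1}, {2}, {3}}"
    using exhaust_3 by (auto simp: card_1_singleton_iff)
  then show "elem_sym 1 x = x 1 + x 2 + x 3"
    by (simp add: elem_sym_def)
  have "{A :: 3 set. card A = 2} = {{1, 2}, {2, 3}, {3, 1}}"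
  proof (intro equalityI subsetI)
    fix A :: "3 set" assume "A \<in> {A. card A = 2}"
    then obtain a b where "A = {a, b}" "a \<noteq> b" by (auto simp: card_2_iff)
    then show "A \<in> {{1, 2}, {2, 3}, {3, 1}}"
      using exhaust_3[of a] exhaust_3[of b] by (auto simp: insert_commute)
  qed auto
  moreover have "{1, 2} \<noteq> {2, 3 :: 3}" "{1, 2} \<noteq> {3, 1 :: 3}" "{2, 3} \<noteq> {3, 1 :: 3}"
    by (auto simp: set_eq_iff forall_3)
  ultimately show "elem_sym 2 x = x 1 * x 2 + x 2 * x 3 + x 3 * x 1"
    by (simp add: elem_sym_def)
  have "{A :: 3 set. card A = 3} = {UNIV}"
    using card_subset_eq[OF finite_class.finite_UNIV subset_UNIV, of "_ :: 3 set"] by auto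
  then have "elem_sym 3 x = (\<Prod>i\<in>UNIV. x i)"
    unfolding elem_sym_def by simp
  then show "elem_sym 3 x = x 1 * x 2 * x 3"
    unfolding UNIV_3 by (simp add: mult.assoc)
qed

text \<open>
  This and the next lemma are what makes the elementary symmetric polynomials of the
  $\tau_i=\varepsilon s_{v(i)}$ depend on the vertex only through a power of $\varepsilon$.
\<close>

lemma elem_sym_bij:
  fixes x :: "3 \<Rightarrow> 'a::comm_ring_1"
  assumes "bij v"
  shows "elem_sym k (\<lambda>i. x (v i)) = elem_sym k x"
proof -
  have inj: "inj v" using assms by (rule bij_is_inj)
  have "(\<Sum>A | card A = k. \<Prod>i\<in>A. x (v i)) = (\<Sum>A | card A = k. \<Prod>i\<in>A. x i)"
  proof (rule sum.reindex_bij_witness[of _ "\<lambda>A. v -` A" "\<lambda>A. v ` A"])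
    fix A :: "3 set" assume "A \<in> {A. card A = k}"
    then show "v -` v ` A = A" "v ` A \<in> {A. card A = k}" "v ` v -` A = A" "v -` A \<in> {A. card A = k}"
      using assms inj
      by (simp_all add: inj_vimage_image_eq card_image inj_on_subset bij_is_surj card_vimage_inj)
    show "(\<Prod>i\<in>v ` A. x i) = (\<Prod>i\<in>A. x (v i))"
      by (simp add: prod.reindex inj_on_subset[OF inj])
  qed
  then show ?thesis by (simp add: elem_sym_def)
qed

lemma elem_sym_scale:
  fixes x :: "3 \<Rightarrow> 'a::comm_ring_1"
  shows "elem_sym k (\<lambda>i. c * x i) = c ^ k * elem_sym k x"
proof -
  have "(\<Sum>A | card A = k. \<Prod>i\<in>A. c * x i) = (\<Sum>A | card A = k. c ^ k * (\<Prod>i\<in>A. x i))"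
    by (rule sum.cong) (auto simp: prod.distrib)
  then show ?thesis by (simp add: elem_sym_def sum_distrib_left)
qed

lemma poly_eval_elem_sym: "poly_eval g (elem_sym k x) = elem_sym k (\<lambda>i. poly_eval g (x i))"
proof -
  have "poly_eval g (\<Prod>i\<in>A. x i) = (\<Prod>i\<in>A. poly_eval g (x i))" for A
    by (induction A rule: infinite_finite_induct) (simp_all add: poly_eval_mult)
  then show ?thesis by (simp add: elem_sym_def poly_eval_sum)
qed

section \<open>Permutations of three indices\<close>

lemma exists_distinct_3:
  fixes i j :: 3
  assumes "i \<noteq> j"
  shows "\<exists>k. distinct [i, j, k]"
proof -
  have "card {i, j} < CARD(3)" using assms by simp
  then have "{i, j} \<noteq> UNIV" by (metis less_irrefl)
  then show ?thesis using assms by auto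
qed

text \<open>
  The function on three indices with given values. It serves both as the one-line notation
  of a permutation and as a point of affine 3-space.
\<close>

definition perm3 :: "'a \<Rightarrow> 'a \<Rightarrow> 'a \<Rightarrow> 3 \<Rightarrow> 'a" where
  "perm3 a b c = (\<lambda>m. if m = 1 then a else if m = 2 then b else c)"

lemma perm3_simps [simp]: "perm3 a b c 1 = a" "perm3 a b c 2 = b" "perm3 a b c 3 = c"
  by (simp_all add: perm3_def)

lemma perm3_transpose:
  "perm3 a b c \<circ> Transposition.transpose 1 2 = perm3 b a c"
  "perm3 a b c \<circ> Transposition.transpose 2 3 = perm3 a c b"
  "perm3 a b c \<circ> Transposition.transpose 1 3 = perm3 c b a"
  by (simp_all add: fun_eq_iff forall_3 Transposition.transpose_def)

lemma bij_perm3_iff: "bij (perm3 a b c) \<longleftrightarrow> distinct [a, b, c :: 3]"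
proof -
  have "bij (perm3 a b c) \<longleftrightarrow> inj (perm3 a b c)"
    using finite_UNIV_inj_surj[of "perm3 a b c"] by (auto simp: bij_def)
  then show ?thesis
    by (auto simp: inj_def forall_3)
qed

lemma eq_perm3: "v = perm3 (v 1) (v 2) (v 3)"
  by (simp add: fun_eq_iff forall_3)

section \<open>Primality of the roots\<close>

text \<open>
  A substitute for unique factorization: divisibility by a product of pairwise
  non-associated primes is obtained one prime at a time.
\<close>

lemma prime_elem_mult_dvd:
  fixes p q r :: "'a :: idom"
  assumes "prime_elem p" "\<not> p dvd q" "p dvd r" "q dvd r"
  shows "p * q dvd r"
proof -
  obtain r' where r': "r = q * r'" using assms(4) by (rule dvdE)
  then have "p dvd r'" using assms(1-3) prime_elem_dvd_multD by blast
  then show ?thesis by (auto simp: r' mult_dvd_mono mult.commute)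
qed

text \<open>
  Substituting \<open>q\<close> for the variable \<open>i\<close> is the quotient map modulo \<open>var i - q\<close>: by
  \<open>dvd_poly_eval_diff\<close> it does not change a polynomial modulo \<open>var i - q\<close>. The assumption says
  that \<open>q\<close> does not involve the variable \<open>i\<close>.
\<close>

lemma var_diff_dvd_iff:
  fixes q :: "'x::linorder int_poly"
  assumes "poly_eval (var(i := q)) q = q"
  shows "var i - q dvd r \<longleftrightarrow> poly_eval (var(i := q)) r = 0"
proof
  assume "var i - q dvd r"
  then obtain r' where "r = (var i - q) * r'" by (rule dvdE)
  then show "poly_eval (var(i := q)) r = 0"
    by (simp add: poly_eval_simps assms)
next
  assume "poly_eval (var(i := q)) r = 0"
  moreover have "var i - q dvd poly_eval var r - poly_eval (var(i := q)) r"
    by (rule dvd_poly_eval_diff) simp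
  ultimately show "var i - q dvd r"
    by (simp add: poly_eval_var_id)
qed

text \<open>
  The kernel of a homomorphism into an integral domain is prime.
\<close>

lemma prime_elem_var_diff:
  fixes q :: "'x::linorder int_poly"
  assumes q: "poly_eval (var(i := q)) q = q" and "var i \<noteq> q"
  shows "prime_elem (var i - q)"
  using assms(2) by (auto simp: prime_elem_def var_diff_dvd_iff[OF q] poly_eval_mult)

lemma prime_elem_uminus: "prime_elem (- p) \<longleftrightarrow> prime_elem (p :: 'a::idom)"
  by (simp add: prime_elem_def)

lemma not_dvd_by_poly_eval:
  assumes "poly_eval g p = 0" "poly_eval g q \<noteq> 0"
  shows "\<not> p dvd q"
  using assms by (auto simp: poly_eval_mult elim!: dvdE)

lemma s_poly_eq:
  "s_poly 1 = var 1 - var 2" "s_poly 2 = var 2 - var 3" "s_poly 3 = var 3 - var 1"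
proof -
  have "(3 :: 3) + 1 = 1" by simp
  then show "s_poly 3 = var 3 - var 1" by (simp only: s_poly_def s_of_def)
qed (simp_all add: s_poly_def s_of_def)

lemma poly_eval_s_poly: "poly_eval g (s_poly i) = g i - g (i + 1)"
  by (simp add: s_poly_def s_of_def poly_eval_diff)

lemma poly_eval_neq: "poly_eval g p \<noteq> poly_eval g q \<Longrightarrow> p \<noteq> q"
  by auto

lemma prime_elem_s_poly: "prime_elem (s_poly i)"
proof -
  have "prime_elem (var a - var b)" if "a \<noteq> b" for a b :: 3
  proof (rule prime_elem_var_diff)
    show "var a \<noteq> (var b :: 3 int_poly)"
      by (rule poly_eval_neq[of "\<lambda>m. if m = a then 1 else 0 :: int"]) (use that in simp)
  qed (use that in simp)
  then show ?thesis
    using exhaust_3[of i] by (auto simp: s_poly_eq)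
qed

text \<open>
  Each $s_i-s_j$ has, up to sign, the form $t_a-2t_b+t_c$, so it can be solved for $t_a$.
\<close>

lemma prime_elem_s_poly_diff:
  assumes "i \<noteq> j"
  shows "prime_elem (s_poly i - s_poly j)"
proof -
  have "prime_elem (var a - (2 * var b - var c))" if "a \<noteq> b" "a \<noteq> c" for a b c :: 3
  proof (rule prime_elem_var_diff)
    show "var a \<noteq> (2 * var b - var c :: 3 int_poly)"
      by (rule poly_eval_neq[of "\<lambda>m. if m = a then 1 else 0 :: int"]) (use that in \<open>simp add: poly_eval_simps\<close>)
  qed (use that in \<open>simp add: poly_eval_simps\<close>)
  from this[of 1 2 3] this[of 2 3 1] this[of 3 1 2]
  have "prime_elem (s_poly 1 - s_poly 2)" "prime_elem (s_poly 2 - s_poly 3)" "prime_elem (s_poly 3 - s_poly 1)"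
    by (simp_all add: s_poly_eq algebra_simps)
  moreover from this have "prime_elem (s_poly 2 - s_poly 1)" "prime_elem (s_poly 3 - s_poly 2)" "prime_elem (s_poly 1 - s_poly 3)"
    by (metis minus_diff_eq prime_elem_uminus)+
  ultimately show ?thesis
    using assms exhaust_3[of i] exhaust_3[of j] by auto
qed

lemma poly_eval_s_poly_perm3:
  "poly_eval (perm3 a b c) (s_poly i) = perm3 (a - b) (b - c) (c - a) i"
  using exhaust_3[of i] by (auto simp: s_poly_eq poly_eval_simps)

lemma not_s_poly_dvd: "i \<noteq> j \<Longrightarrow> \<not> s_poly i dvd s_poly j"
  \<comment> \<open>The point $t_{i+2}=1$, $t_i=t_{i+1}=0$: of the three forms, only $s_i$ vanishes there.\<close>
  by (rule not_dvd_by_poly_eval[of "perm3 (if i = 2 then 1 else 0 :: int) (if i = 3 then 1 else 0) (if i = 1 then 1 else 0)"])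
    (use exhaust_3[of i] exhaust_3[of j] in \<open>auto simp: poly_eval_s_poly_perm3\<close>)

text \<open>
  A point at which, of all roots, only $\pm(s_i-s_j)$ vanishes; it shows that $s_i-s_j$ divides no
  other root.
\<close>

lemma s_point:
  fixes i j k :: 3
  assumes "distinct [i, j, k]"
  obtains g :: "3 \<Rightarrow> int" where "poly_eval g (s_poly i) = 1" "poly_eval g (s_poly j) = 1" "poly_eval g (s_poly k) = - 2"
proof -
  define g :: "3 \<Rightarrow> int" where "g = (if k = 1 then perm3 (-1) 1 0 else if k = 2 then perm3 0 (-1) 1 else perm3 1 0 (-1))"
  show thesis
    \<comment> \<open>Solves $g_k-g_{k+1}=-2$ and $g_{k+1}-g_{k+2}=1$ with $g_{k+2}=0$.\<close>
    by (rule that[of g]; use assms exhaust_3[of i] exhaust_3[of j] exhaust_3[of k] in \<open>auto simp: poly_eval_s_poly_perm3 g_def\<close>)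
qed

lemma not_s_poly_diff_dvd:
  assumes "i \<noteq> j"
  shows "\<not> s_poly i - s_poly j dvd s_poly k"
proof -
  obtain l where l: "distinct [i, j, l]" using exists_distinct_3[OF assms] ..
  then obtain g :: "3 \<Rightarrow> int" where
    "poly_eval g (s_poly i) = 1" "poly_eval g (s_poly j) = 1" "poly_eval g (s_poly l) = - 2"
    by (rule s_point)
  moreover have "k = i \<or> k = j \<or> k = l"
    using l exhaust_3[of i] exhaust_3[of j] exhaust_3[of k] exhaust_3[of l] by auto
  ultimately show ?thesis
    by (intro not_dvd_by_poly_eval[of g]) (auto simp: poly_eval_simps)
qed

lemma not_s_poly_diff_dvd_diff:
  assumes "distinct [i, j, k]"
  shows "\<not> s_poly i - s_poly j dvd s_poly i - s_poly k"
proof -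
  obtain g :: "3 \<Rightarrow> int" where
    "poly_eval g (s_poly i) = 1" "poly_eval g (s_poly j) = 1" "poly_eval g (s_poly k) = - 2"
    using s_point[OF assms] .
  then show ?thesis
    by (intro not_dvd_by_poly_eval[of g]) (simp_all add: poly_eval_simps)
qed

section \<open>Polynomial functions on the six permutations\<close>

text \<open>
  The $A_2$ case of the theorem, in Newton form. Writing $x=x_{v(1)}$, $y=x_{v(2)}$, the six functions
  multiplied by \<open>c1\<close>, \dots, \<open>c6\<close> are the double Schubert polynomials
  $1$, $x-x_1$, $x+y-x_1-x_2$, $(x-x_1)(y-x_1)$, $(x-x_1)(x-x_2)$, $(x-x_1)(x-x_2)(y-x_1)$.
  In the order $123$, $213$, $132$, $231$, $312$, $321$ of the permutations, each of them vanishes at all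
  permutations before its own, and at its own it equals, up to sign, the product of the labels of
  the edges to earlier permutations. After subtracting the earlier terms from \<open>u\<close>, the remainder at
  the next permutation is divisible by each of these labels, hence by their product, as they are
  non-associated primes; the quotient is the next coefficient.
\<close>

lemma A2_interpolation:
  fixes x :: "3 \<Rightarrow> 'a::idom" and u :: "(3 \<Rightarrow> 3) \<Rightarrow> 'a"
  assumes prime: "\<And>i j. i \<noteq> j \<Longrightarrow> prime_elem (x i - x j)"
    and not_dvd: "\<And>i j k. distinct [i, j, k] \<Longrightarrow> \<not> x i - x j dvd x i - x k"
    and dvd: "\<And>v i j. bij v \<Longrightarrow> i \<noteq> j \<Longrightarrow>
      x (v i) - x (v j) dvd u v - u (v \<circ> Transposition.transpose i j)"
  shows "\<exists>c1 c2 c3 c4 c5 c6. \<forall>v. bij v \<longrightarrow> u v =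
    c1 + c2 * (x (v 1) - x 1) + c3 * (x (v 1) + x (v 2) - x 1 - x 2)
    + c4 * ((x (v 1) - x 1) * (x (v 2) - x 1)) + c5 * ((x (v 1) - x 1) * (x (v 1) - x 2))
    + c6 * ((x (v 1) - x 1) * (x (v 1) - x 2) * (x (v 2) - x 1))"
proof -
  let ?A = "x 1" and ?B = "x 2" and ?C = "x 3"
  define U where "U a b c = u (perm3 a b c)" for a b c
  have U12: "x a - x b dvd U a b c - U b a c" and U23: "x b - x c dvd U a b c - U a c b"
    and U13: "x a - x c dvd U a b c - U c b a" if "distinct [a, b, c]" for a b c
    using dvd[of "perm3 a b c" 1 2] dvd[of "perm3 a b c" 2 3] dvd[of "perm3 a b c" 1 3] that
    by (simp_all add: U_def bij_perm3_iff perm3_transpose)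
  have "x i - x j dvd y \<longleftrightarrow> x j - x i dvd y" for i j y
    by (metis minus_diff_eq minus_dvd_iff)
  moreover have "x i - x j dvd x k - x l \<longleftrightarrow> x i - x j dvd x l - x k" for i j k l
    by (metis dvd_minus_iff minus_diff_eq)
  ultimately have not_dvd': "\<not> ?B - ?A dvd ?C - ?A" "\<not> ?C - ?A dvd ?C - ?B" "\<not> ?C - ?A dvd ?B - ?A"
    "\<not> ?C - ?B dvd ?B - ?A"
    using not_dvd[of 1 2 3, simplified] not_dvd[of 3 1 2, simplified]
      not_dvd[of 1 3 2, simplified] not_dvd[of 2 3 1, simplified] by blast+
  have prime': "prime_elem (?B - ?A)" "prime_elem (?C - ?A)" "prime_elem (?C - ?B)"
    using prime by simp_all
  have "?B - ?A dvd U 2 1 3 - U 1 2 3"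
    using U12[of 2 1 3] by simp
  then obtain c2 where "U 2 1 3 - U 1 2 3 = (?B - ?A) * c2" ..
  then have c2: "U 2 1 3 = U 1 2 3 + c2 * (?B - ?A)"
    by (simp add: algebra_simps)
  have "?C - ?B dvd U 1 3 2 - U 1 2 3"
    using U23[of 1 3 2] by simp
  then obtain c3 where "U 1 3 2 - U 1 2 3 = (?C - ?B) * c3" ..
  then have c3: "U 1 3 2 = U 1 2 3 + c3 * (?C - ?B)"
    by (simp add: algebra_simps)
  \<comment> \<open>The remainder at 231, whose earlier neighbours are 213 and 132.\<close>
  define R4 where "R4 = U 2 3 1 - U 1 2 3 - c2 * (?B - ?A) - c3 * (?C - ?A)"
  have "?C - ?A dvd R4"
  proof -
    have "R4 = (U 2 3 1 - U 2 1 3) - c3 * (?C - ?A)"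
      unfolding R4_def c2 by (simp add: algebra_simps)
    then show ?thesis using U23[of 2 3 1] by (simp add: dvd_diff)
  qed
  moreover have "?B - ?A dvd R4"
  proof -
    have "R4 = (U 2 3 1 - U 1 3 2) - (c2 + c3) * (?B - ?A)"
      unfolding R4_def c3 by (simp add: algebra_simps)
    then show ?thesis using U13[of 2 3 1] by (simp add: dvd_diff)
  qed
  ultimately have "(?B - ?A) * (?C - ?A) dvd R4"
    by (intro prime_elem_mult_dvd prime' not_dvd')
  then obtain c4 where "R4 = (?B - ?A) * (?C - ?A) * c4" ..
  then have c4: "U 2 3 1 = U 1 2 3 + c2 * (?B - ?A) + c3 * (?C - ?A) + c4 * ((?B - ?A) * (?C - ?A))"
    unfolding R4_def by (simp add: algebra_simps)
  \<comment> \<open>The remainder at 312, whose earlier neighbours are 132 and 213.\<close>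
  define R5 where "R5 = U 3 1 2 - U 1 2 3 - c2 * (?C - ?A) - c3 * (?C - ?B)"
  have "?C - ?A dvd R5"
  proof -
    have "R5 = (U 3 1 2 - U 1 3 2) - c2 * (?C - ?A)"
      unfolding R5_def c3 by (simp add: algebra_simps)
    then show ?thesis using U12[of 3 1 2] by (simp add: dvd_diff)
  qed
  moreover have "?C - ?B dvd R5"
  proof -
    have "R5 = (U 3 1 2 - U 2 1 3) - (c2 + c3) * (?C - ?B)"
      unfolding R5_def c2 by (simp add: algebra_simps)
    then show ?thesis using U13[of 3 1 2] by (simp add: dvd_diff)
  qed
  ultimately have "(?C - ?A) * (?C - ?B) dvd R5"
    by (intro prime_elem_mult_dvd prime' not_dvd')
  then obtain c5 where "R5 = (?C - ?A) * (?C - ?B) * c5" ..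
  then have c5: "U 3 1 2 = U 1 2 3 + c2 * (?C - ?A) + c3 * (?C - ?B) + c5 * ((?C - ?A) * (?C - ?B))"
    unfolding R5_def by (simp add: algebra_simps)
  \<comment> \<open>The remainder at 321, whose earlier neighbours are 231, 312 and 123.\<close>
  define R6 where "R6 = U 3 2 1 - U 1 2 3 - c2 * (?C - ?A) - c3 * (?C - ?A)
    - c4 * ((?C - ?A) * (?B - ?A)) - c5 * ((?C - ?A) * (?C - ?B))"
  have "?C - ?B dvd R6"
  proof -
    have "R6 = (U 3 2 1 - U 2 3 1) - (c2 + c5 * (?C - ?A)) * (?C - ?B)"
      unfolding R6_def c4 by (simp add: algebra_simps)
    then show ?thesis using U12[of 3 2 1] by (simp add: dvd_diff)
  qed
  moreover have "?B - ?A dvd R6"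
  proof -
    have "R6 = (U 3 2 1 - U 3 1 2) - (c3 + c4 * (?C - ?A)) * (?B - ?A)"
      unfolding R6_def c5 by (simp add: algebra_simps)
    then show ?thesis using U23[of 3 2 1] by (simp add: dvd_diff)
  qed
  ultimately have "(?C - ?B) * (?B - ?A) dvd R6"
    by (intro prime_elem_mult_dvd prime' not_dvd')
  moreover have "?C - ?A dvd R6"
  proof -
    have "R6 = (U 3 2 1 - U 1 2 3) - (c2 + c3 + c4 * (?B - ?A) + c5 * (?C - ?B)) * (?C - ?A)"
      unfolding R6_def by (simp add: algebra_simps)
    then show ?thesis using U13[of 3 2 1] by (simp add: dvd_diff)
  qed
  moreover have "\<not> ?C - ?A dvd (?C - ?B) * (?B - ?A)"
    using not_dvd' prime' prime_elem_dvd_mult_iff by blast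
  ultimately have "(?C - ?A) * ((?C - ?B) * (?B - ?A)) dvd R6"
    by (intro prime_elem_mult_dvd[OF prime'(2)])
  then obtain c6 where "R6 = (?C - ?A) * ((?C - ?B) * (?B - ?A)) * c6" ..
  then have c6: "U 3 2 1 = U 1 2 3 + c2 * (?C - ?A) + c3 * (?C - ?A) + c4 * ((?C - ?A) * (?B - ?A))
      + c5 * ((?C - ?A) * (?C - ?B)) + c6 * ((?C - ?A) * (?C - ?B) * (?B - ?A))"
    unfolding R6_def by (simp add: algebra_simps)
  have "u v = U 1 2 3 + c2 * (x (v 1) - x 1) + c3 * (x (v 1) + x (v 2) - x 1 - x 2)
    + c4 * ((x (v 1) - x 1) * (x (v 2) - x 1)) + c5 * ((x (v 1) - x 1) * (x (v 1) - x 2))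
    + c6 * ((x (v 1) - x 1) * (x (v 1) - x 2) * (x (v 2) - x 1))" if v: "bij v" for v
  proof -
    have u: "u v = U (v 1) (v 2) (v 3)" unfolding U_def by (simp flip: eq_perm3)
    have "distinct [v 1, v 2, v 3]"
      using v unfolding bij_perm3_iff[symmetric] eq_perm3[symmetric] .
    then consider "v 1 = 1" "v 2 = 2" "v 3 = 3" | "v 1 = 2" "v 2 = 1" "v 3 = 3"
      | "v 1 = 1" "v 2 = 3" "v 3 = 2" | "v 1 = 2" "v 2 = 3" "v 3 = 1"
      | "v 1 = 3" "v 2 = 1" "v 3 = 2" | "v 1 = 3" "v 2 = 2" "v 3 = 1"
      using exhaust_3[of "v 1"] exhaust_3[of "v 2"] exhaust_3[of "v 3"] by auto
    then show ?thesis
      unfolding u by cases (simp_all add: c2 c3 c4 c5 c6)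
  qed
  then show ?thesis by blast
qed

lemma quadratic_zero:
  fixes x :: "3 \<Rightarrow> 'a::idom"
  assumes "inj x" "\<And>i. c0 + c1 * x i + c2 * x i ^ 2 = 0"
  shows "c0 = 0 \<and> c1 = 0 \<and> c2 = 0"
proof -
  have neq: "x 1 \<noteq> x 2" "x 1 \<noteq> x 3" "x 2 \<noteq> x 3" using assms(1) by (auto dest: injD)
  have *: "c1 + c2 * (x i + x j) = 0" if "x i \<noteq> x j" for i j
  proof -
    have "(x i - x j) * (c1 + c2 * (x i + x j))
        = (c0 + c1 * x i + c2 * x i ^ 2) - (c0 + c1 * x j + c2 * x j ^ 2)"
      by (simp add: algebra_simps power2_eq_square)
    then show ?thesis using that by (simp add: assms(2))
  qed
  have "c2 * (x 2 - x 3) = (c1 + c2 * (x 1 + x 2)) - (c1 + c2 * (x 1 + x 3))"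
    by (simp add: algebra_simps)
  then have "c2 = 0" using neq by (simp add: *)
  then show ?thesis using *[OF neq(1)] assms(2)[of 1] by simp
qed

text \<open>
  Fixing $v(1)=i$ leaves two values of $x_{v(2)}$, which kills a polynomial of degree at most
  1 in it; its two coefficients are quadratics in $x_{v(1)}$ with the three roots $x_1,x_2,x_3$.
\<close>

lemma A2_vanishing:
  fixes x :: "3 \<Rightarrow> 'a::idom" and c :: "nat \<Rightarrow> nat \<Rightarrow> 'a"
  assumes inj: "inj x"
    and zero: "\<And>v :: 3 \<Rightarrow> 3. bij v \<Longrightarrow> (\<Sum>a<3. \<Sum>b<2. c a b * (x (v 1) ^ a * x (v 2) ^ b)) = 0"
    and ab: "a < 3" "b < 2"
  shows "c a b = 0"
proof -
  define P where "P b y = c 0 b + c 1 b * y + c 2 b * y ^ 2" for b y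
  have lin: "P 0 (x i) + P 1 (x i) * x j = 0" if "i \<noteq> j" for i j
  proof -
    have "\<exists>k. distinct [i, j, k]" by (rule exists_distinct_3[OF that])
    then obtain k where "distinct [i, j, k]" ..
    then have "bij (perm3 i j k)" by (simp only: bij_perm3_iff)
    from zero[OF this] show ?thesis
      by (simp add: P_def numeral_3_eq_3 numeral_2_eq_2 algebra_simps)
  qed
  have "P 1 (x i) = 0 \<and> P 0 (x i) = 0" for i
  proof -
    define j where "j = i + 1"
    have "i \<noteq> j" using exhaust_3[of i] by (auto simp: j_def)
    then obtain k where "distinct [i, j, k]" using exists_distinct_3 by blast
    then have "x j \<noteq> x k" "i \<noteq> j" "i \<noteq> k" using inj by (auto dest: injD)
    moreover have "P 1 (x i) * (x j - x k) = (P 0 (x i) + P 1 (x i) * x j) - (P 0 (x i) + P 1 (x i) * x k)"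
      by (simp add: algebra_simps)
    ultimately have "P 1 (x i) * (x j - x k) = 0"
      by (simp only: lin[OF \<open>i \<noteq> j\<close>] lin[OF \<open>i \<noteq> k\<close>] diff_self)
    with \<open>x j \<noteq> x k\<close> have "P 1 (x i) = 0" by simp
    then show ?thesis using lin[OF \<open>i \<noteq> j\<close>] by simp
  qed
  then have "c 0 b = 0 \<and> c 1 b = 0 \<and> c 2 b = 0" if "b < 2" for b
    using that unfolding P_def
    by (intro quadratic_zero[OF inj]) (auto simp: less_2_cases_iff)
  moreover have "a = 0 \<or> a = 1 \<or> a = 2" using ab(1) by linarith
  ultimately show ?thesis using ab(2) by blast
qed

section \<open>The graph in coordinates\<close>

lemma linear_form_of_int_scale:
  assumes "\<And>k. x $ k \<in> \<int>"
  shows "linear_form (of_int c *\<^sub>R x) = of_int c * linear_form x"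
proof -
  have "\<lfloor>of_int c * x $ k\<rfloor> = c * \<lfloor>x $ k\<rfloor>" for k
    using assms[of k] by (auto elim!: Ints_cases simp flip: of_int_mult)
  then show ?thesis
    by (simp add: linear_form_def sum_distrib_left mult.assoc)
qed

lemma linear_form_diff:
  assumes "\<And>k. x $ k \<in> \<int>" "\<And>k. y $ k \<in> \<int>"
  shows "linear_form (x - y) = linear_form x - linear_form y"
proof -
  have "\<lfloor>x $ k - y $ k\<rfloor> = \<lfloor>x $ k\<rfloor> - \<lfloor>y $ k\<rfloor>" for k
    using assms(1)[of k] assms(2)[of k] by (auto elim!: Ints_cases simp flip: of_int_diff)
  then show ?thesis
    by (simp add: linear_form_def left_diff_distrib sum_subtractf)
qed

lemma linear_form_s_vec: "linear_form (s_vec i) = s_poly i"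
proof -
  have "\<lfloor>- 1 :: real\<rfloor> = - 1" by linarith
  then show ?thesis
    using exhaust_3[of i] by (auto simp: linear_form_def s_vec_nth s_poly_eq sum_3)
qed

text \<open>
  The identification of the vertices with signed permutations is the one given by the action on
  the $s_i$.
\<close>

lemma vertex_eqI:
  assumes "w \<in> W_G2" "acts_by w v e" "e = 1 \<or> e = - 1"
  shows "vertex w = (v, e)"
proof -
  have "\<exists>v e. vertex w = (v, e) \<and> acts_by w v e \<and> (e = 1 \<or> e = - 1)"
  proof (cases "w \<in> W_long")
    case True
    then show ?thesis using psi_acts[OF is_psi_psi] vertex_long by blast
  next
    case False
    then obtain w' where "w = rho \<circ> w'" "w' \<in> W_long" using assms(1) unfolding W_G2_decomp by blast
    then show ?thesis using acts_by_rho_comp[OF psi_acts[OF is_psi_psi]] vertex_rho by blast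
  qed
  then show ?thesis using acts_by_unique[OF assms(2) _ assms(3)] by blast
qed

lemma vertexE:
  assumes "w \<in> W_G2"
  obtains v e where "vertex w = (v, e)" "acts_by w v e" "e = 1 \<or> e = - 1" "bij v"
proof -
  obtain v e where *: "acts_by w v e" "e = 1 \<or> e = - 1" using W_G2_acts[OF assms] by blast
  then have "bij v" by (simp add: acts_by_def)
  with * vertex_eqI[OF assms *] show thesis using that by blast
qed

definition vertex_at :: "(3 \<Rightarrow> 3) \<Rightarrow> int \<Rightarrow> real^3 \<Rightarrow> real^3" where
  "vertex_at v e = inv_into W_G2 vertex (v, e)"

lemma vertex_at:
  assumes "bij v" "e = 1 \<or> e = - 1"
  shows "vertex_at v e \<in> W_G2" "vertex (vertex_at v e) = (v, e)"
proof -
  have "(v, e) \<in> vertex ` W_G2"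
    using assms bij_betw_vertex by (auto simp: bij_betw_def)
  then show "vertex_at v e \<in> W_G2" "vertex (vertex_at v e) = (v, e)"
    unfolding vertex_at_def by (rule inv_into_into, rule f_inv_into_f)
qed

lemma vertex_at_eq: "w \<in> W_G2 \<Longrightarrow> vertex w = (v, e) \<Longrightarrow> vertex_at v e = w"
  unfolding vertex_at_def using bij_betw_vertex by (metis bij_betw_def inv_into_f_f)

lemma vertex_at_acts:
  assumes "bij v" "e = 1 \<or> e = - 1"
  shows "acts_by (vertex_at v e) v e"
  using vertex_at[OF assms] by (metis vertexE Pair_inject)

text \<open>
  As reflections are involutions, the edges can be read from their first end point.
\<close>

lemma G2_edge_iff:
  "G2_edge w w' \<alpha> \<longleftrightarrow> w \<in> W_G2 \<and> \<alpha> \<in> G2_roots \<and> w' = w \<circ> reflection \<alpha>"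
proof -
  have "u \<circ> reflection \<alpha> \<circ> reflection \<alpha> = u" for u :: "real^3 \<Rightarrow> real^3"
    by (simp add: fun_eq_iff reflection_invol)
  then show ?thesis
    unfolding G2_edge_def using weyl_comp[OF _ weyl_reflection, of _ G2_roots \<alpha>] by metis
qed

lemma short_root: "s_vec k \<in> G2_roots" "- s_vec k \<in> G2_roots"
  by (auto simp: G2_roots_def)

lemma long_root: "i \<noteq> j \<Longrightarrow> s_vec i - s_vec j \<in> G2_roots"
  by (auto simp: G2_roots_def long_roots_def)

lemma short_edge:
  assumes "w \<in> W_G2" "acts_by w v e" "e = 1 \<or> e = - 1" "distinct [i, j, k]"
  shows "w \<circ> reflection (s_vec k) \<in> W_G2"
    "vertex (w \<circ> reflection (s_vec k)) = (v \<circ> Transposition.transpose i j, - e)"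
    "G2_label w (s_vec k) = of_int e * s_poly (v k)"
proof -
  show *: "w \<circ> reflection (s_vec k) \<in> W_G2"
    using assms(1) short_root by (intro weyl_comp weyl_reflection)
  have "acts_by (reflection (s_vec k)) (Transposition.transpose i j) (- 1)"
    using assms(4) by (intro acts_by_short) auto
  from acts_by_comp[OF assms(2) this]
  show "vertex (w \<circ> reflection (s_vec k)) = (v \<circ> Transposition.transpose i j, - e)"
    by (intro vertex_eqI *) (use assms(3) in auto)
  show "G2_label w (s_vec k) = of_int e * s_poly (v k)"
    using assms(2) by (simp add: G2_label_def acts_by_def linear_form_of_int_scale s_vec_integral linear_form_s_vec)
qed

lemma long_edge:
  assumes "w \<in> W_G2" "acts_by w v e" "e = 1 \<or> e = - 1" "i \<noteq> j"
  shows "w \<circ> reflection (s_vec i - s_vec j) \<in> W_G2"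
    "vertex (w \<circ> reflection (s_vec i - s_vec j)) = (v \<circ> Transposition.transpose i j, e)"
    "G2_label w (s_vec i - s_vec j) = of_int e * (s_poly (v i) - s_poly (v j))"
proof -
  show *: "w \<circ> reflection (s_vec i - s_vec j) \<in> W_G2"
    using assms(1,4) long_root by (intro weyl_comp weyl_reflection)
  from acts_by_comp[OF assms(2) acts_by_long[OF assms(4)]]
  show "vertex (w \<circ> reflection (s_vec i - s_vec j)) = (v \<circ> Transposition.transpose i j, e)"
    by (intro vertex_eqI *) (use assms(3) in auto)
  have "w (s_vec i - s_vec j) = of_int e *\<^sub>R (s_vec (v i) - s_vec (v j))"
    using assms(2) by (simp add: acts_by_def linear_diff scaleR_right_diff_distrib)
  then show "G2_label w (s_vec i - s_vec j) = of_int e * (s_poly (v i) - s_poly (v j))"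
    by (simp only: G2_label_def linear_form_of_int_scale linear_form_diff s_vec_integral
        linear_form_s_vec vector_minus_component Ints_diff)
qed

lemma of_int_sign_mult_dvd_iff:
  "e = 1 \<or> e = - 1 \<Longrightarrow> of_int e * p dvd (q :: 'a::comm_ring_1) \<longleftrightarrow> p dvd q"
  by auto

lemma HT_G2_dvd_short:
  assumes h: "h \<in> carrier HT_G2" and "bij v" "e = 1 \<or> e = - 1" "distinct [i, j, k]"
  shows "s_poly (v k) dvd h (vertex_at v e) - h (vertex_at (v \<circ> Transposition.transpose i j) (- e))"
proof -
  note * = vertex_at(1)[OF assms(2,3)] vertex_at_acts[OF assms(2,3)] assms(3,4)
  have "G2_label (vertex_at v e) (s_vec k) dvd
      h (vertex_at v e) - h (vertex_at v e \<circ> reflection (s_vec k))"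
    using h *(1) short_root by (auto simp: HT_G2_def G2_edge_iff)
  then show ?thesis
    using vertex_at_eq[OF short_edge(1,2)[OF *]]
    by (simp add: short_edge(3)[OF *] of_int_sign_mult_dvd_iff[OF assms(3)])
qed

lemma HT_G2_dvd_long:
  assumes h: "h \<in> carrier HT_G2" and "bij v" "e = 1 \<or> e = - 1" "i \<noteq> j"
  shows "s_poly (v i) - s_poly (v j) dvd
    h (vertex_at v e) - h (vertex_at (v \<circ> Transposition.transpose i j) e)"
proof -
  note * = vertex_at(1)[OF assms(2,3)] vertex_at_acts[OF assms(2,3)] assms(3,4)
  have "G2_label (vertex_at v e) (s_vec i - s_vec j) dvd
      h (vertex_at v e) - h (vertex_at v e \<circ> reflection (s_vec i - s_vec j))"
    using h *(1) long_root[OF assms(4)] by (auto simp: HT_G2_def G2_edge_iff)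
  then show ?thesis
    using vertex_at_eq[OF long_edge(1,2)[OF *]]
    by (simp add: long_edge(3)[OF *] of_int_sign_mult_dvd_iff[OF assms(3)])
qed

text \<open>
  The generators at the vertex $(v,\varepsilon)$, as functions on all pairs, so that statements about
  values involve no group elements.
\<close>

definition gen_value :: "(3 \<Rightarrow> 3) \<Rightarrow> int \<Rightarrow> gen \<Rightarrow> 3 int_poly" where
  "gen_value v e x = (case x of Tau i \<Rightarrow> of_int e * s_poly (v i) | Tvar i \<Rightarrow> var i
     | Fvar \<Rightarrow> if e = 1 then elem_sym 3 s_poly else 0)"

lemma gen_value_simps [simp]:
  "gen_value v e (Tau i) = of_int e * s_poly (v i)"
  "gen_value v e (Tvar i) = var i"
  "gen_value v e Fvar = (if e = 1 then elem_sym 3 s_poly else 0)"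
  by (simp_all add: gen_value_def)

lemma gen_class_eq_gen_value:
  assumes "w \<in> W_G2" "vertex w = (v, e)"
  shows "gen_class x w = gen_value v e x"
  using assms by (cases x) (simp_all add: tau_class_def t_class_def f_class_def elem_sym_3)

lemma s_poly_sum: "distinct [i, j, k] \<Longrightarrow> s_poly i + s_poly j + s_poly k = 0"
  using exhaust_3[of i] exhaust_3[of j] exhaust_3[of k] by (auto simp: s_poly_eq)

text \<open>
  For $\tau_m$ the difference is $\varepsilon(s_{v(m)}+s_{v((i\,j)m)})$, because the sign changes along the edge.
  This is $2\varepsilon s_{v(k)}$ for $m=k$ and $-\varepsilon s_{v(k)}$ otherwise, since $s_1+s_2+s_3=0$. For $f$
  it is $\pm s_1s_2s_3$.
\<close>

lemma gen_value_dvd_short: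
  assumes "bij v" "e = 1 \<or> e = - 1" "distinct [i, j, k]"
  shows "s_poly (v k) dvd gen_value v e x - gen_value (v \<circ> Transposition.transpose i j) (- e) x"
proof (cases x)
  case (Tau m)
  have "distinct [v i, v j, v k]"
    using assms(1,3) by (auto simp: bij_def dest: injD)
  from s_poly_sum[OF this] have *: "s_poly (v i) + s_poly (v j) = - s_poly (v k)" "s_poly (v j) + s_poly (v i) = - s_poly (v k)"
    by (simp_all add: algebra_simps eq_neg_iff_add_eq_0)
  have "m = i \<or> m = j \<or> m = k"
    using assms(3) exhaust_3[of i] exhaust_3[of j] exhaust_3[of k] exhaust_3[of m] by auto
  moreover have "gen_value v e x - gen_value (v \<circ> Transposition.transpose i j) (- e) x
      = of_int e * (s_poly (v m) + s_poly (v (Transposition.transpose i j m)))"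
    by (simp add: Tau algebra_simps)
  ultimately show ?thesis
    using assms(3) by (auto simp: * transpose_apply_other)
next
  case Fvar
  have "s_poly l dvd elem_sym 3 s_poly" for l
    using exhaust_3[of l] by (auto simp: elem_sym_3)
  then show ?thesis using assms(2) by (auto simp: Fvar)
qed simp

lemma gen_value_dvd_long:
  assumes "i \<noteq> j"
  shows "s_poly (v i) - s_poly (v j) dvd gen_value v e x - gen_value (v \<circ> Transposition.transpose i j) e x"
proof (cases x)
  case (Tau m)
  have "gen_value v e x - gen_value (v \<circ> Transposition.transpose i j) e x
      = of_int e * (s_poly (v m) - s_poly (v (Transposition.transpose i j m)))"
    by (simp add: Tau algebra_simps)
  moreover have "s_poly (v i) - s_poly (v j) dvd s_poly (v m) - s_poly (v (Transposition.transpose i j m))"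
    by (auto simp: Transposition.transpose_def) (metis dvd_minus_iff dvd_refl minus_diff_eq)
  ultimately show ?thesis by simp
qed simp_all

lemma gen_class_dvd:
  assumes "G2_edge w w' \<alpha>"
  shows "G2_label w \<alpha> dvd gen_class x w - gen_class x w'"
proof -
  have w: "w \<in> W_G2" and \<alpha>: "\<alpha> \<in> G2_roots" and w': "w' = w \<circ> reflection \<alpha>"
    using assms by (auto simp: G2_edge_iff)
  from w obtain v e where ve: "vertex w = (v, e)" "acts_by w v e" "e = 1 \<or> e = - 1" "bij v"
    by (rule vertexE)
  have short: "G2_label w (s_vec k) dvd gen_class x w - gen_class x (w \<circ> reflection (s_vec k))" for k
  proof -
    \<comment> \<open>Indices are residues modulo 3, so these are the two indices other than \<open>k\<close>.\<close>
    have "distinct [k + 1, k + 2, k]" using exhaust_3[of k] by auto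
    note * = short_edge[OF w ve(2,3) this]
    show ?thesis
      unfolding gen_class_eq_gen_value[OF w ve(1)] gen_class_eq_gen_value[OF *(1,2)] *(3)
        of_int_sign_mult_dvd_iff[OF ve(3)]
      by (rule gen_value_dvd_short) fact+
  qed
  have uminus: "G2_label w (- \<beta>) = - G2_label w \<beta>" if "\<beta> \<in> G2_roots" for \<beta>
    using linear_form_of_int_scale[of "w \<beta>" "- 1"] root_integral[OF weyl_root[OF w that]] ve(2)
    by (simp add: G2_label_def acts_by_def linear_neg)
  from \<alpha> consider k where "\<alpha> = s_vec k" | k where "\<alpha> = - s_vec k"
    | i j where "\<alpha> = s_vec i - s_vec j" "i \<noteq> j"
    by (auto simp: G2_roots_def long_roots_def)
  then show ?thesis
  proof cases
    case 1
    then show ?thesis using short w' by simp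
  next
    case 2
    then show ?thesis using short w' by (simp add: uminus short_root reflection_uminus)
  next
    case 3
    note * = long_edge[OF w ve(2,3) 3(2)]
    show ?thesis
      unfolding w' 3(1) gen_class_eq_gen_value[OF w ve(1)] gen_class_eq_gen_value[OF *(1,2)] *(3)
        of_int_sign_mult_dvd_iff[OF ve(3)]
      by (rule gen_value_dvd_long[OF 3(2)])
  qed
qed

lemma canonical_hom_apply:
  assumes "w \<in> W_G2" "vertex w = (v, e)"
  shows "canonical_hom p w = poly_eval (gen_value v e) p"
proof -
  have "(\<lambda>x. gen_class x w) = gen_value v e"
    using gen_class_eq_gen_value[OF assms] by auto
  then show ?thesis using assms(1) by (simp add: canonical_hom_def)
qed

lemma canonical_hom_in_carrier: "canonical_hom p \<in> carrier HT_G2"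
proof -
  have "G2_label w \<alpha> dvd canonical_hom p w - canonical_hom p w'" if "G2_edge w w' \<alpha>" for w w' \<alpha>
  proof -
    have "w \<in> W_G2" "w' \<in> W_G2" using that by (auto simp: G2_edge_def)
    then show ?thesis
      using dvd_poly_eval_diff[OF gen_class_dvd[OF that]] by (simp add: canonical_hom_def)
  qed
  then show ?thesis by (auto simp: HT_G2_def canonical_hom_def)
qed

lemma canonical_hom_ring_hom: "canonical_hom \<in> ring_hom gen_ring HT_G2"
  using canonical_hom_in_carrier
  by (auto simp: ring_hom_def gen_ring_def HT_G2_def canonical_hom_def poly_eval_simps fun_eq_iff)

lemma canonical_hom_var: "canonical_hom (var x) = gen_class x"
  by (cases x) (auto simp: canonical_hom_def fun_eq_iff tau_class_def t_class_def f_class_def)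

section \<open>Surjectivity\<close>

text \<open>
  The structure map that makes the polynomials in the seven generators an algebra over
  $\mathbf{Z}[t_1,t_2,t_3]$.
\<close>

definition scalar :: "3 int_poly \<Rightarrow> gen int_poly" where
  "scalar = poly_eval (\<lambda>i. var (Tvar i))"

lemma scalar_simps [simp]:
  "scalar (var i) = var (Tvar i)" "scalar 0 = 0" "scalar 1 = 1"
  "scalar (p + q) = scalar p + scalar q" "scalar (p - q) = scalar p - scalar q"
  "scalar (- p) = - scalar p" "scalar (p * q) = scalar p * scalar q"
  by (simp_all add: scalar_def poly_eval_simps)

lemma poly_eval_scalar [simp]: "poly_eval (gen_value v e) (scalar p) = p"
  by (simp add: scalar_def poly_eval_compose poly_eval_var_id)

text \<open>
  On each half of the graph the interpolating function is a polynomial in $\tau_1,\tau_2$, because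
  $\tau_i$ takes the value $\varepsilon s_{v(i)}$.
\<close>

lemma A2_interpolation_s_poly:
  assumes e: "e = 1 \<or> e = - 1"
    and dvd: "\<And>v i j. bij v \<Longrightarrow> i \<noteq> j \<Longrightarrow>
      s_poly (v i) - s_poly (v j) dvd u v - u (v \<circ> Transposition.transpose i j)"
  obtains p where "\<And>v. bij v \<Longrightarrow> poly_eval (gen_value v e) p = u v"
proof -
  let ?x = "\<lambda>i. of_int e * s_poly i"
  have diff: "?x i - ?x j = of_int e * (s_poly i - s_poly j)" for i j
    by (simp add: algebra_simps)
  have "\<exists>c1 c2 c3 c4 c5 c6. \<forall>v. bij v \<longrightarrow> u v =
    c1 + c2 * (?x (v 1) - ?x 1) + c3 * (?x (v 1) + ?x (v 2) - ?x 1 - ?x 2)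
    + c4 * ((?x (v 1) - ?x 1) * (?x (v 2) - ?x 1)) + c5 * ((?x (v 1) - ?x 1) * (?x (v 1) - ?x 2))
    + c6 * ((?x (v 1) - ?x 1) * (?x (v 1) - ?x 2) * (?x (v 2) - ?x 1))"
  proof (rule A2_interpolation)
    fix i j :: 3
    assume "i \<noteq> j"
    then show "prime_elem (?x i - ?x j)"
      using e prime_elem_s_poly_diff[of i j] prime_elem_s_poly_diff[of j i] by auto
  next
    fix i j k :: 3
    assume "distinct [i, j, k]"
    then show "\<not> ?x i - ?x j dvd ?x i - ?x k"
      using e not_s_poly_diff_dvd_diff unfolding diff by auto
  qed (use dvd in \<open>simp only: diff of_int_sign_mult_dvd_iff[OF e]\<close>)
  then obtain c1 c2 c3 c4 c5 c6 where c: "\<forall>v. bij v \<longrightarrow> u v =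
    c1 + c2 * (?x (v 1) - ?x 1) + c3 * (?x (v 1) + ?x (v 2) - ?x 1 - ?x 2)
    + c4 * ((?x (v 1) - ?x 1) * (?x (v 2) - ?x 1)) + c5 * ((?x (v 1) - ?x 1) * (?x (v 1) - ?x 2))
    + c6 * ((?x (v 1) - ?x 1) * (?x (v 1) - ?x 2) * (?x (v 2) - ?x 1))" by blast
  define X Y A B where XY: "X = var (Tau 1)" "Y = var (Tau 2)" "A = scalar (?x 1)" "B = scalar (?x 2)"
  show thesis
    by (rule that[of "scalar c1 + scalar c2 * (X - A) + scalar c3 * (X + Y - A - B)
      + scalar c4 * ((X - A) * (Y - A)) + scalar c5 * ((X - A) * (X - B))
      + scalar c6 * ((X - A) * (X - B) * (Y - A))"])
      (simp add: poly_eval_simps XY c del: scalar_simps)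
qed

lemma elem_sym_3_s_poly_dvd:
  assumes "\<And>k. s_poly k dvd r"
  shows "elem_sym 3 s_poly dvd r"
proof -
  have "\<not> s_poly 1 dvd s_poly 2 * s_poly 3"
    using not_s_poly_dvd[of 1 2] not_s_poly_dvd[of 1 3] prime_elem_s_poly[of 1]
    by (simp add: prime_elem_dvd_mult_iff)
  then have "s_poly 1 * (s_poly 2 * s_poly 3) dvd r"
    by (intro prime_elem_mult_dvd assms prime_elem_s_poly not_s_poly_dvd) simp_all
  then show ?thesis by (simp add: elem_sym_3 mult.assoc)
qed

text \<open>
  The function \<open>k\<close> is $h-p$, where $p$ interpolates $h$ on the half $\varepsilon=-$, and \<open>u\<close> is the quotient
  of its restriction to the other half by $e_3(s)$.
\<close>

lemma canonical_hom_surj: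
  assumes h: "h \<in> carrier HT_G2"
  shows "\<exists>p. canonical_hom p = h"
proof -
  obtain p where p: "\<And>v. bij v \<Longrightarrow> poly_eval (gen_value v (- 1)) p = h (vertex_at v (- 1))"
    by (rule A2_interpolation_s_poly[of "- 1" "\<lambda>v. h (vertex_at v (- 1))"]) (use HT_G2_dvd_long[OF h] in auto)
  define k where "k v e = h (vertex_at v e) - poly_eval (gen_value v e) p" for v e
  have k_minus: "k v (- 1) = 0" if "bij v" for v
    using p[OF that] by (simp add: k_def)
  have "elem_sym 3 s_poly dvd k v 1" if v: "bij v" for v
  proof (rule elem_sym_3_s_poly_dvd)
    fix m
    obtain l where l: "m = v l" using v by (metis bij_pointE)
    have d: "distinct [l + 1, l + 2, l]" using exhaust_3[of l] by auto
    let ?v' = "v \<circ> Transposition.transpose (l + 1) (l + 2)"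
    \<comment> \<open>The edge in the direction $s_l$ leads to the half on which $k$ vanishes.\<close>
    have "s_poly (v l) dvd (h (vertex_at v 1) - h (vertex_at ?v' (- 1)))
        - (poly_eval (gen_value v 1) p - poly_eval (gen_value ?v' (- 1)) p)"
      using HT_G2_dvd_short[OF h v _ d, of 1] gen_value_dvd_short[OF v _ d, of 1]
      by (intro dvd_diff[OF _ dvd_poly_eval_diff]) auto
    also have "\<dots> = k v 1 - k ?v' (- 1)" by (simp add: k_def)
    also have "k ?v' (- 1) = 0" using v by (intro k_minus bij_comp) auto
    finally show "s_poly m dvd k v 1" by (simp add: l)
  qed
  then obtain u where u: "\<And>v. bij v \<Longrightarrow> k v 1 = elem_sym 3 s_poly * u v"
    unfolding dvd_def by metis
  obtain q where q: "\<And>v. bij v \<Longrightarrow> poly_eval (gen_value v 1) q = u v"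
  proof (rule A2_interpolation_s_poly[of 1 u])
    fix v :: "3 \<Rightarrow> 3" and i j :: 3
    assume v: "bij v" and ij: "i \<noteq> j"
    let ?v' = "v \<circ> Transposition.transpose i j" and ?r = "s_poly (v i) - s_poly (v j)"
    have v': "bij ?v'" using v by (intro bij_comp) auto
    have vij: "v i \<noteq> v j" using v ij by (auto simp: bij_def dest: injD)
    have "?r dvd (h (vertex_at v 1) - h (vertex_at ?v' 1))
        - (poly_eval (gen_value v 1) p - poly_eval (gen_value ?v' 1) p)"
      using HT_G2_dvd_long[OF h v _ ij, of 1] gen_value_dvd_long[OF ij]
      by (intro dvd_diff[OF _ dvd_poly_eval_diff]) auto
    also have "\<dots> = elem_sym 3 s_poly * (u v - u ?v')"
      using u[OF v] u[OF v'] by (simp add: k_def algebra_simps)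
    \<comment> \<open>Cancel $e_3(s)$, which is prime to the label.\<close>
    finally show "?r dvd u v - u ?v'"
      using prime_elem_s_poly_diff[OF vij] not_s_poly_diff_dvd[OF vij]
      by (auto simp: prime_elem_dvd_mult_iff elem_sym_3)
  qed auto
  have "canonical_hom (p + var Fvar * q) = h"
  proof (rule extensionalityI)
    show "canonical_hom (p + var Fvar * q) \<in> extensional W_G2"
      by (simp add: canonical_hom_def)
    show "h \<in> extensional W_G2" using h by (simp add: HT_G2_def)
    fix w assume w: "w \<in> W_G2"
    then obtain v e where ve: "vertex w = (v, e)" "e = 1 \<or> e = - 1" "bij v" by (rule vertexE)
    have "poly_eval (gen_value v e) (p + var Fvar * q) = h (vertex_at v e)"
      using ve(2) p[OF ve(3)] q[OF ve(3)] u[OF ve(3)]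
      by (auto simp: poly_eval_simps k_def algebra_simps)
    then show "canonical_hom (p + var Fvar * q) w = h w"
      using canonical_hom_apply[OF w ve(1)] vertex_at_eq[OF w ve(1)] by simp
  qed
  then show ?thesis ..
qed

section \<open>A spanning set modulo the relations\<close>

lemma G2_relations_eq:
  "G2_relations =
    {elem_sym 1 (\<lambda>i. var (Tau i)),
     elem_sym 2 (\<lambda>i. var (Tau i)) - scalar (elem_sym 2 s_poly),
     2 * var Fvar - elem_sym 3 (\<lambda>i. var (Tau i)) - scalar (elem_sym 3 s_poly),
     var Fvar ^ 2 - var Fvar * scalar (elem_sym 3 s_poly)}"
proof -
  have "s_of (\<lambda>i. var (Tvar i)) = (\<lambda>i. scalar (s_poly i))"
    by (simp add: fun_eq_iff scalar_def poly_eval_s_poly s_of_def)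
  then have "scalar (elem_sym k s_poly) = elem_sym k (s_of (\<lambda>i. var (Tvar i)))" for k
    by (simp add: scalar_def poly_eval_elem_sym)
  then show ?thesis by (simp add: G2_relations_def Let_def)
qed

text \<open>
  At $(v,\varepsilon)$ one has $e_k(\tau)=\varepsilon^ke_k(s)$ and $e_1(s)=0$. Hence $e_3(\tau)+e_3(s)$ is $2e_3(s)$ or
  $0$, which is the value of $2f$.
\<close>

lemma poly_eval_G2_relations:
  assumes "r \<in> G2_relations" "bij v" "e = 1 \<or> e = - 1"
  shows "poly_eval (gen_value v e) r = 0"
proof -
  have tau: "poly_eval (gen_value v e) (elem_sym k (\<lambda>i. var (Tau i))) = of_int e ^ k * elem_sym k s_poly"
    for k e
    by (simp add: poly_eval_elem_sym elem_sym_scale elem_sym_bij[OF assms(2)])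
  have "elem_sym 1 s_poly = 0"
    unfolding elem_sym_1 by (rule s_poly_sum) simp
  then show ?thesis
    using assms(1,3)
    by (auto simp: G2_relations_eq poly_eval_simps tau power2_eq_square simp del: One_nat_def)
qed

abbreviation G2_ideal :: "gen int_poly set" where
  "G2_ideal \<equiv> Idl\<^bsub>gen_ring\<^esub> G2_relations"

lemma G2_ideal_ideal: "ideal G2_ideal gen_ring"
proof -
  interpret cring gen_ring by (rule cring_gen_ring)
  show ?thesis by (rule genideal_ideal) (simp add: gen_ring_def)
qed

lemma G2_ideal_mult: "p \<in> G2_ideal \<Longrightarrow> q * p \<in> G2_ideal"
  using ideal.I_l_closed[OF G2_ideal_ideal, of p q] by (simp add: gen_ring_def)

lemma G2_ideal_add: "p \<in> G2_ideal \<Longrightarrow> q \<in> G2_ideal \<Longrightarrow> p + q \<in> G2_ideal"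
  using additive_subgroup.a_closed[OF ideal.axioms(1)[OF G2_ideal_ideal], of p q]
  by (simp add: gen_ring_def)

lemma G2_ideal_minus: "p \<in> G2_ideal \<Longrightarrow> - p \<in> G2_ideal"
  using G2_ideal_mult[of p "- 1"] by simp

lemma G2_ideal_diff: "p \<in> G2_ideal \<Longrightarrow> q \<in> G2_ideal \<Longrightarrow> p - q \<in> G2_ideal"
  using G2_ideal_add[OF _ G2_ideal_minus, of p q] by simp

lemma G2_ideal_zero: "0 \<in> G2_ideal"
  using additive_subgroup.zero_closed[OF ideal.axioms(1)[OF G2_ideal_ideal]]
  by (simp add: gen_ring_def)

lemma G2_ideal_relation: "r \<in> G2_relations \<Longrightarrow> r \<in> G2_ideal"
proof -
  interpret cring gen_ring by (rule cring_gen_ring)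
  assume "r \<in> G2_relations"
  then show ?thesis using genideal_self[of G2_relations] by (auto simp: gen_ring_def)
qed

text \<open>
  The rewriting rules hidden in the relations: $\tau_2$ is a root of $X^2+\tau_1X+\tau_1^2+e_2(s)$,
  because $\tau_2+\tau_3=-\tau_1$ and $\tau_2\tau_3=\tau_1^2+e_2(s)$. For the same reason
  $e_3(\tau)=\tau_1\tau_2\tau_3=\tau_1^3+e_2(s)\tau_1$, so that the third relation expresses $\tau_1^3$.
\<close>

lemma
  defines "x \<equiv> var (Tau 1)" and "y \<equiv> var (Tau 2)" and "z \<equiv> var (Tau 3)" and "f \<equiv> var Fvar"
    and "E2 \<equiv> scalar (elem_sym 2 s_poly)" and "E3 \<equiv> scalar (elem_sym 3 s_poly)"
  shows Tau3_cong: "z - (- x - y) \<in> G2_ideal"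
    and Tau2_square_cong: "y ^ 2 - (- (x ^ 2) - x * y - E2) \<in> G2_ideal"
    and Tau1_cube_cong: "x ^ 3 - (2 * f - E2 * x - E3) \<in> G2_ideal"
    and Fvar_square_cong: "f ^ 2 - E3 * f \<in> G2_ideal"
proof -
  let ?r1 = "x + y + z" and ?r2 = "x * y + y * z + z * x - E2"
    and ?r3 = "2 * f - x * y * z - E3"
  have r: "?r1 \<in> G2_ideal" "?r2 \<in> G2_ideal" "?r3 \<in> G2_ideal" "f ^ 2 - f * E3 \<in> G2_ideal"
    unfolding x_def y_def z_def f_def E2_def E3_def
      elem_sym_1[of "\<lambda>i. var (Tau i)", symmetric] elem_sym_2[of "\<lambda>i. var (Tau i)", symmetric]
      elem_sym_3[of "\<lambda>i. var (Tau i)", symmetric]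
    by (intro G2_ideal_relation; simp only: G2_relations_eq insert_iff simp_thms)+
  show "z - (- x - y) \<in> G2_ideal" using r(1) by (simp add: algebra_simps)
  have "(x + y) * ?r1 - ?r2 \<in> G2_ideal"
    by (intro G2_ideal_diff G2_ideal_mult r)
  also have "(x + y) * ?r1 - ?r2 = y ^ 2 - (- (x ^ 2) - x * y - E2)"
    by (simp add: algebra_simps power2_eq_square)
  finally show "y ^ 2 - (- (x ^ 2) - x * y - E2) \<in> G2_ideal" .
  have "x ^ 2 * ?r1 - x * ?r2 - ?r3 \<in> G2_ideal"
    by (intro G2_ideal_diff G2_ideal_mult r)
  also have "x ^ 2 * ?r1 - x * ?r2 - ?r3 = x ^ 3 - (2 * f - E2 * x - E3)"
    by (simp add: algebra_simps power2_eq_square power3_eq_cube)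
  finally show "x ^ 3 - (2 * f - E2 * x - E3) \<in> G2_ideal" .
  show "f ^ 2 - E3 * f \<in> G2_ideal" using r(4) by (simp add: mult.commute)
qed

definition basis_index :: "(nat \<times> nat \<times> nat) set" where
  "basis_index = {..<3} \<times> {..<2} \<times> {..<2}"

definition basis_monom :: "nat \<times> nat \<times> nat \<Rightarrow> gen int_poly" where
  "basis_monom = (\<lambda>(a, b, d). var (Tau 1) ^ a * var (Tau 2) ^ b * var Fvar ^ d)"

definition in_basis_span :: "gen int_poly \<Rightarrow> bool" where
  "in_basis_span p \<longleftrightarrow> (\<exists>c. p - (\<Sum>k\<in>basis_index. scalar (c k) * basis_monom k) \<in> G2_ideal)"

lemma in_basis_span_cong:
  assumes "p - q \<in> G2_ideal" "in_basis_span q"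
  shows "in_basis_span p"
proof -
  obtain c where "q - (\<Sum>k\<in>basis_index. scalar (c k) * basis_monom k) \<in> G2_ideal"
    using assms(2) unfolding in_basis_span_def by blast
  from G2_ideal_add[OF assms(1) this] show ?thesis
    unfolding in_basis_span_def by (intro exI[of _ c]) simp
qed

lemma in_basis_span_add:
  assumes "in_basis_span p" "in_basis_span q"
  shows "in_basis_span (p + q)"
proof -
  obtain c d where "p - (\<Sum>k\<in>basis_index. scalar (c k) * basis_monom k) \<in> G2_ideal"
    "q - (\<Sum>k\<in>basis_index. scalar (d k) * basis_monom k) \<in> G2_ideal"
    using assms unfolding in_basis_span_def by blast
  from G2_ideal_add[OF this] show ?thesis
    unfolding in_basis_span_def
    by (intro exI[of _ "\<lambda>k. c k + d k"]) (simp add: distrib_right sum.distrib algebra_simps)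
qed

lemma in_basis_span_scalar_mult:
  assumes "in_basis_span p"
  shows "in_basis_span (scalar r * p)"
proof -
  obtain c where "p - (\<Sum>k\<in>basis_index. scalar (c k) * basis_monom k) \<in> G2_ideal"
    using assms unfolding in_basis_span_def by blast
  from G2_ideal_mult[OF this, of "scalar r"] show ?thesis
    unfolding in_basis_span_def
    by (intro exI[of _ "\<lambda>k. r * c k"]) (simp add: right_diff_distrib sum_distrib_left mult.assoc)
qed

lemma in_basis_span_basis_monom:
  assumes "a < 3" "b < 2" "d < 2"
  shows "in_basis_span (var (Tau 1) ^ a * var (Tau 2) ^ b * var Fvar ^ d)"
proof -
  have "(\<Sum>k\<in>basis_index. scalar (if k = (a, b, d) then 1 else 0) * basis_monom k) = basis_monom (a, b, d)"
    using assms by (subst sum.remove[of _ "(a, b, d)"]) (auto simp: basis_index_def intro!: sum.neutral)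
  then show ?thesis
    unfolding in_basis_span_def using G2_ideal_zero
    by (intro exI[of _ "\<lambda>k. if k = (a, b, d) then 1 else 0"]) (simp add: basis_monom_def)
qed

lemma in_basis_span_zero: "in_basis_span 0"
  using in_basis_span_scalar_mult[OF in_basis_span_basis_monom[of 0 0 0], of 0] by simp

lemma in_basis_span_minus: "in_basis_span p \<Longrightarrow> in_basis_span (- p)"
  using in_basis_span_scalar_mult[of p "- 1"] by simp

lemma in_basis_span_diff: "in_basis_span p \<Longrightarrow> in_basis_span q \<Longrightarrow> in_basis_span (p - q)"
  using in_basis_span_add[OF _ in_basis_span_minus, of p q] by simp

text \<open>
  The following three lemmas show that the span is closed under multiplication by $f$, $\tau_1$ and
  $\tau_2$. They come in this order because rewriting $\tau_1^3$ produces a factor $f$, and rewriting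
  $\tau_2^2$ produces factors $\tau_1$; each lemma thus reduces its one critical power to the lemmas
  before it.
\<close>

lemma in_basis_span_mult_if_basis:
  assumes basis: "\<And>a b d. a < 3 \<Longrightarrow> b < 2 \<Longrightarrow> d < 2 \<Longrightarrow>
      in_basis_span (g * (var (Tau 1) ^ a * var (Tau 2) ^ b * var Fvar ^ d))"
    and "in_basis_span p"
  shows "in_basis_span (g * p)"
proof -
  obtain c where c: "p - (\<Sum>k\<in>basis_index. scalar (c k) * basis_monom k) \<in> G2_ideal"
    using assms(2) unfolding in_basis_span_def by blast
  have "in_basis_span (\<Sum>k\<in>K. scalar (c k) * (g * basis_monom k))" if "finite K" "K \<subseteq> basis_index" for K
    using that
    by (induction K rule: finite_induct)
       (auto intro!: in_basis_span_zero in_basis_span_add in_basis_span_scalar_mult basis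
         simp: basis_index_def basis_monom_def)
  then have "in_basis_span (g * (\<Sum>k\<in>basis_index. scalar (c k) * basis_monom k))"
    by (simp add: basis_index_def sum_distrib_left mult.left_commute)
  moreover have "g * p - g * (\<Sum>k\<in>basis_index. scalar (c k) * basis_monom k) \<in> G2_ideal"
    using G2_ideal_mult[OF c, of g] by (simp add: right_diff_distrib)
  ultimately show ?thesis by (rule in_basis_span_cong[rotated])
qed

lemma in_basis_span_Fvar_mult:
  assumes "in_basis_span p"
  shows "in_basis_span (var Fvar * p)"
  using _ assms
proof (rule in_basis_span_mult_if_basis)
  fix a b d :: nat
  assume ab: "a < 3" "b < 2" "d < 2"
  let ?m = "var (Tau 1) ^ a * var (Tau 2) ^ b"
  have "d = 0 \<or> d = 1" using ab(3) by auto
  then show "in_basis_span (var Fvar * (?m * var Fvar ^ d))"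
  proof
    assume "d = 0"
    then show ?thesis using in_basis_span_basis_monom[OF ab(1,2), of 1] by (simp add: mult_ac)
  next
    assume "d = 1"
    have "in_basis_span (scalar (elem_sym 3 s_poly) * (?m * var Fvar ^ 1))"
      by (intro in_basis_span_scalar_mult in_basis_span_basis_monom ab) simp
    moreover have "var Fvar * (?m * var Fvar ^ d) - scalar (elem_sym 3 s_poly) * (?m * var Fvar ^ 1)
        = ?m * (var Fvar ^ 2 - scalar (elem_sym 3 s_poly) * var Fvar)"
      unfolding \<open>d = 1\<close> by (simp add: algebra_simps power2_eq_square del: scalar_simps)
    ultimately show ?thesis
      using G2_ideal_mult[OF Fvar_square_cong, of ?m] in_basis_span_cong by metis
  qed
qed

lemma in_basis_span_Tau1_mult:
  assumes "in_basis_span p"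
  shows "in_basis_span (var (Tau 1) * p)"
  using _ assms
proof (rule in_basis_span_mult_if_basis)
  fix a b d :: nat
  assume ab: "a < 3" "b < 2" "d < 2"
  let ?m = "var (Tau 2) ^ b * var Fvar ^ d"
  have "a + 1 < 3 \<or> a = 2" using ab(1) by auto
  then show "in_basis_span (var (Tau 1) * (var (Tau 1) ^ a * var (Tau 2) ^ b * var Fvar ^ d))"
  proof
    assume "a + 1 < 3"
    from in_basis_span_basis_monom[OF this ab(2,3)] show ?thesis by (simp add: mult_ac)
  next
    assume a: "a = 2"
    have m: "in_basis_span (var (Tau 1) ^ i * ?m)" if "i < 3" for i
      using in_basis_span_basis_monom[OF that ab(2,3)] by (simp add: mult_ac)
    let ?q = "var Fvar * ?m + var Fvar * ?m - scalar (elem_sym 2 s_poly) * (var (Tau 1) ^ 1 * ?m)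
       - scalar (elem_sym 3 s_poly) * (var (Tau 1) ^ 0 * ?m)"
    have "in_basis_span ?q"
      using m[of 0]
      by (intro in_basis_span_diff in_basis_span_add in_basis_span_scalar_mult in_basis_span_Fvar_mult m) simp_all
    moreover have "var (Tau 1) * (var (Tau 1) ^ a * var (Tau 2) ^ b * var Fvar ^ d) - ?q
        = ?m * (var (Tau 1) ^ 3 - (2 * var Fvar - scalar (elem_sym 2 s_poly) * var (Tau 1)
            - scalar (elem_sym 3 s_poly)))"
      unfolding a by (simp add: algebra_simps power2_eq_square power3_eq_cube del: scalar_simps)
    ultimately show ?thesis
      using G2_ideal_mult[OF Tau1_cube_cong, of ?m] in_basis_span_cong by metis
  qed
qed

lemma in_basis_span_Tau2_mult:
  assumes "in_basis_span p"
  shows "in_basis_span (var (Tau 2) * p)"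
  using _ assms
proof (rule in_basis_span_mult_if_basis)
  fix a b d :: nat
  assume ab: "a < 3" "b < 2" "d < 2"
  let ?m = "var (Tau 1) ^ a * var Fvar ^ d"
  have "b = 0 \<or> b = 1" using ab(2) by auto
  then show "in_basis_span (var (Tau 2) * (var (Tau 1) ^ a * var (Tau 2) ^ b * var Fvar ^ d))"
  proof
    assume "b = 0"
    then show ?thesis using in_basis_span_basis_monom[OF ab(1), of 1 d] ab(3) by (simp add: mult_ac)
  next
    assume b: "b = 1"
    have m: "in_basis_span (var (Tau 2) ^ j * ?m)" if "j < 2" for j
      using in_basis_span_basis_monom[OF ab(1) that ab(3)] by (simp add: mult_ac)
    let ?q = "- (var (Tau 1) * (var (Tau 1) * (var (Tau 2) ^ 0 * ?m)))
       - var (Tau 1) * (var (Tau 2) ^ 1 * ?m)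
       - scalar (elem_sym 2 s_poly) * (var (Tau 2) ^ 0 * ?m)"
    have "in_basis_span ?q"
      by (intro in_basis_span_diff in_basis_span_minus in_basis_span_scalar_mult in_basis_span_Tau1_mult m) simp_all
    moreover have "var (Tau 2) * (var (Tau 1) ^ a * var (Tau 2) ^ b * var Fvar ^ d) - ?q
        = ?m * (var (Tau 2) ^ 2 - (- (var (Tau 1) ^ 2) - var (Tau 1) * var (Tau 2)
            - scalar (elem_sym 2 s_poly)))"
      unfolding b by (simp add: algebra_simps power2_eq_square del: scalar_simps)
    ultimately show ?thesis
      using G2_ideal_mult[OF Tau2_square_cong, of ?m] in_basis_span_cong by metis
  qed
qed

lemma in_basis_span_all: "in_basis_span p"
proof (induction p rule: int_poly_induct)
  case one
  then show ?case using in_basis_span_basis_monom[of 0 0 0] by simp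
next
  case (var_mult g p)
  show ?case
  proof (cases g)
    case (Tau i)
    consider "i = 1" | "i = 2" | "i = 3" using exhaust_3 by blast
    then show ?thesis
    proof cases
      case 3
      have "in_basis_span (- (var (Tau 1) * p) - var (Tau 2) * p)"
        by (intro in_basis_span_diff in_basis_span_minus in_basis_span_Tau1_mult in_basis_span_Tau2_mult var_mult)
      moreover have "var (Tau 3) * p - (- (var (Tau 1) * p) - var (Tau 2) * p) \<in> G2_ideal"
        using G2_ideal_mult[OF Tau3_cong, of p] by (simp add: algebra_simps)
      ultimately show ?thesis unfolding Tau 3 by (rule in_basis_span_cong[rotated])
    qed (simp_all add: Tau in_basis_span_Tau1_mult in_basis_span_Tau2_mult var_mult)
  next
    case (Tvar i)
    then show ?thesis using in_basis_span_scalar_mult[OF var_mult, of "var i"] by simp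
  qed (simp add: in_basis_span_Fvar_mult var_mult)
qed (rule in_basis_span_diff)

section \<open>The kernel\<close>

text \<open>
  The values of a combination at the half $\varepsilon=-$ involve only the coefficients with $d=0$,
  since $f=0$ there. At the other half the remaining coefficients appear multiplied
  by $e_3(s)\neq 0$.
\<close>

lemma basis_independent:
  assumes zero: "\<And>v e. bij v \<Longrightarrow> e = 1 \<or> e = - 1 \<Longrightarrow>
      poly_eval (gen_value v e) (\<Sum>k\<in>basis_index. scalar (c k) * basis_monom k) = 0"
    and "k \<in> basis_index"
  shows "c k = 0"
proof -
  let ?E3 = "elem_sym 3 s_poly"
  have sum: "(\<Sum>k\<in>basis_index. F k) = (\<Sum>a<3. \<Sum>b<2. F (a, b, 0) + F (a, b, 1))" for F :: "_ \<Rightarrow> 3 int_poly"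
    by (simp add: basis_index_def sum.cartesian_product' numeral_2_eq_2)
  have inj: "inj s_poly"
    using not_s_poly_dvd by (metis dvd_refl injI)
  have minus: "c (a, b, 0) = 0" if "a < 3" "b < 2" for a b
  proof (rule A2_vanishing[where x = "\<lambda>i. - s_poly i" and c = "\<lambda>a b. c (a, b, 0)"])
    fix v :: "3 \<Rightarrow> 3" assume v: "bij v"
    show "(\<Sum>a<3. \<Sum>b<2. c (a, b, 0) * ((- s_poly (v 1)) ^ a * (- s_poly (v 2)) ^ b)) = 0"
      using zero[OF v, of "- 1"] by (simp add: poly_eval_simps sum basis_monom_def)
  qed (use inj that in \<open>auto simp: inj_def\<close>)
  have plus: "c (a, b, 1) * ?E3 = 0" if "a < 3" "b < 2" for a b
  proof (rule A2_vanishing[where x = s_poly and c = "\<lambda>a b. c (a, b, 1) * ?E3"])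
    fix v :: "3 \<Rightarrow> 3" assume v: "bij v"
    have "(\<Sum>a<3. \<Sum>b<2. c (a, b, 1) * ?E3 * (s_poly (v 1) ^ a * s_poly (v 2) ^ b))
      = (\<Sum>a<3. \<Sum>b<2. c (a, b, 0) * (s_poly (v 1) ^ a * s_poly (v 2) ^ b)
          + c (a, b, 1) * (s_poly (v 1) ^ a * s_poly (v 2) ^ b * ?E3))"
      by (intro sum.cong) (auto simp: minus mult_ac)
    then show "(\<Sum>a<3. \<Sum>b<2. c (a, b, 1) * ?E3 * (s_poly (v 1) ^ a * s_poly (v 2) ^ b)) = 0"
      using zero[OF v, of 1] by (simp add: poly_eval_simps sum basis_monom_def)
  qed (use inj that in auto)
  have "?E3 \<noteq> 0"
    using prime_elem_s_poly by (auto simp: elem_sym_3 prime_elem_def)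
  with minus plus show ?thesis
    using assms(2) by (auto simp: basis_index_def less_2_cases_iff)
qed

lemma canonical_hom_eq_zero_iff:
  "canonical_hom p = \<zero>\<^bsub>HT_G2\<^esub> \<longleftrightarrow>
    (\<forall>v e. bij v \<longrightarrow> e = 1 \<or> e = - 1 \<longrightarrow> poly_eval (gen_value v e) p = 0)"
proof
  assume zero: "canonical_hom p = \<zero>\<^bsub>HT_G2\<^esub>"
  show "\<forall>v e. bij v \<longrightarrow> e = 1 \<or> e = - 1 \<longrightarrow> poly_eval (gen_value v e) p = 0"
  proof (intro allI impI)
    fix v :: "3 \<Rightarrow> 3" and e :: int
    assume "bij v" "e = 1 \<or> e = - 1"
    note * = vertex_at[OF this]
    show "poly_eval (gen_value v e) p = 0"
      using canonical_hom_apply[OF *, of p] *(1) by (simp add: zero HT_G2_def)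
  qed
next
  assume zero: "\<forall>v e. bij v \<longrightarrow> e = 1 \<or> e = - 1 \<longrightarrow> poly_eval (gen_value v e) p = 0"
  have "canonical_hom p w = 0" if "w \<in> W_G2" for w
    using that zero canonical_hom_apply[OF that] by (metis vertexE)
  then show "canonical_hom p = \<zero>\<^bsub>HT_G2\<^esub>"
    by (auto simp: HT_G2_def canonical_hom_def fun_eq_iff)
qed

text \<open>
  Subtracting from a kernel element its normal form gives an element of the ideal, which lies in the
  kernel. So the normal form lies in the kernel as well, and its coefficients vanish.
\<close>

lemma kernel_canonical_hom: "a_kernel gen_ring HT_G2 canonical_hom = G2_ideal"
proof -
  interpret R: cring gen_ring by (rule cring_gen_ring)
  interpret S: cring HT_G2 by (rule cring_HT_G2)
  interpret h: ring_hom_ring gen_ring HT_G2 canonical_hom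
    by (intro ring_hom_ringI2 R.ring_axioms S.ring_axioms canonical_hom_ring_hom)
  have kernel: "p \<in> a_kernel gen_ring HT_G2 canonical_hom \<longleftrightarrow>
      (\<forall>v e. bij v \<longrightarrow> e = 1 \<or> e = - 1 \<longrightarrow> poly_eval (gen_value v e) p = 0)" for p
    unfolding a_kernel_def' canonical_hom_eq_zero_iff[symmetric] by (simp add: gen_ring_def)
  show ?thesis
  proof
    show le: "G2_ideal \<subseteq> a_kernel gen_ring HT_G2 canonical_hom"
    proof (rule R.genideal_minimal)
      show "ideal (a_kernel gen_ring HT_G2 canonical_hom) gen_ring"
        by (rule h.kernel_is_ideal)
    qed (use poly_eval_G2_relations in \<open>auto simp: kernel\<close>)
    show "a_kernel gen_ring HT_G2 canonical_hom \<subseteq> G2_ideal"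
    proof
      fix p assume p: "p \<in> a_kernel gen_ring HT_G2 canonical_hom"
      obtain c where c: "p - (\<Sum>k\<in>basis_index. scalar (c k) * basis_monom k) \<in> G2_ideal"
        using in_basis_span_all[of p] unfolding in_basis_span_def by blast
      let ?n = "\<Sum>k\<in>basis_index. scalar (c k) * basis_monom k"
      have "poly_eval (gen_value v e) ?n = 0" if "bij v" "e = 1 \<or> e = - 1" for v e
        using p subsetD[OF le c] that unfolding kernel poly_eval_diff by auto
      then have "c k = 0" if "k \<in> basis_index" for k
        using basis_independent that by blast
      then have "?n = 0" by (intro sum.neutral) simp
      with c show "p \<in> G2_ideal" by simp
    qed
  qed
qed

theorem theorem1p1:
  shows "canonical_hom \<in> ring_hom gen_ring HT_G2 \<and>
    (\<forall>i. canonical_hom (var (Tau i)) = tau_class i) \<and>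
    (\<forall>i. canonical_hom (var (Tvar i)) = t_class i) \<and>
    canonical_hom (var Fvar) = f_class \<and>
    canonical_hom ` carrier gen_ring = carrier HT_G2 \<and>
    a_kernel gen_ring HT_G2 canonical_hom = Idl\<^bsub>gen_ring\<^esub> G2_relations"
proof -
  have "canonical_hom ` carrier gen_ring = carrier HT_G2"
    using canonical_hom_in_carrier canonical_hom_surj by (auto simp: gen_ring_def image_iff) metis
  then show ?thesis
    using canonical_hom_ring_hom kernel_canonical_hom by (simp add: canonical_hom_var)
qed

end
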